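(* Fix constants $0<\alpha<\frac12$, $0\le\gamma<\frac12$, $\sigma_0>0$, $\bar c\ge 1$, $C>0$. There exist positive constants $c,c_1,C_1$, depending only on these fixed constants, such that for all sufficiently large $n,p$, every integer $k\ge1$ with $k\le c\min\{p^{\gamma},\frac{n}{\log p}\}$, and every $\xi\in\Xi(q,\bar c)$ with $1\le q\le Ck$ (the sparse loading regime), the minimax expected length of $(1-\alpha)$-level confidence intervals for $\xi^{\intercal}\beta$ over $\Theta(k,\mathrm{I},\sigma_0)$ satisfies $$c_1\frac{\|\xi\|_2}{\sqrt n}\;\le\; L^*_\alpha\big(\Theta(k,\mathrm{I},\sigma_0),\xi^{\intercal}\beta\big)\;\le\; C_1\frac{\|\xi\|_2}{\sqrt n}.$$
   Context: Model: one observes $Z=(Z_1,\dots,Z_n)$ with $Z_i=(y_i,X_{i\cdot})\in\mathbb{R}^{p+1}$, $y=X\beta+\epsilon$, where $X\in\mathbb{R}^{n\times p}$ has i.i.d. rows $X_{i\cdot}\sim N_p(0,\Sigma)$, independent of $\epsilon\sim N_n(0,\sigma^2 \mathrm{I})$. Let $\Omega=\Sigma^{-1}$ and $\theta=(\beta,\Omega,\sigma)$; $\mathbb{P}_\theta,\mathbb{E}_\theta$ are the corresponding probability and expectation. $\|x\|_0$ is the number of nonzero entries of $x$, $\mathrm{supp}(x)$ the set of their indices. Parameter space (known design covariance and noise level): $\Theta(k,\mathrm{I},\sigma_0)=\{(\beta,\mathrm{I},\sigma_0):\|\beta\|_0\le k\}$. Loadings: $\Xi(q,\bar c)=\{\xi\in\mathbb{R}^p:\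 \|\xi\|_0=q,\ \xi\ne 0,\ \max_{j\in\mathrm{supp}(\xi)}|\xi_j|\le\bar c\min_{j\in\mathrm{supp}(\xi)}|\xi_j|\}$. Confidence intervals: for a parameter space $\Theta$ and functional $\mathrm{T}$ of $\beta$, $\mathcal{I}_\alpha(\Theta,\mathrm{T})$ is the set of all intervals $\mathrm{CI}=[l(Z),u(Z)]$ with $\inf_{\theta\in\Theta}\mathbb{P}_\theta(l(Z)\le \mathrm{T}(\beta)\le u(Z))\ge 1-\alpha$; the length is $L(\mathrm{CI})=u(Z)-l(Z)$. The minimax expected length is $L^*_\alpha(\Theta,\mathrm{T})=\inf_{\mathrm{CI}\in\mathcal{I}_\alpha(\Theta,\mathrm{T})}\sup_{\theta\in\Theta}\mathbb{E}_\theta L(\mathrm{CI})$. *)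

theory Defs
  imports "HOL-Probability.Probability" "Jordan_Normal_Form.Determinant"
begin

(* A vector of R^p is an element of {..<p} \<rightarrow>\<^sub>E UNIV, since the dimensions n and p vary
   inside the statement; matrices are those of Jordan_Normal_Form. *)

definition vec_supp :: "nat \<Rightarrow> (nat \<Rightarrow> real) \<Rightarrow> nat set" where
  "vec_supp p x = {j \<in> {..<p}. x j \<noteq> 0}"

definition l0_norm :: "nat \<Rightarrow> (nat \<Rightarrow> real) \<Rightarrow> nat" where
  "l0_norm p x = card (vec_supp p x)"

definition lin_fun :: "nat \<Rightarrow> (nat \<Rightarrow> real) \<Rightarrow> (nat \<Rightarrow> real) \<Rightarrow> real" where
  "lin_fun p \<xi> \<beta> = (\<Sum>j<p. \<xi> j * \<beta> j)"

(* The law N_p(0, \<Sigma>), parametrised by the precision matrix \<Omega> = \<Sigma>^{-1} (which is meant to be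
   symmetric positive definite), so that det \<Sigma> = 1 / det \<Omega>. *)
definition mv_normal :: "nat \<Rightarrow> real Matrix.mat \<Rightarrow> (nat \<Rightarrow> real) measure" where
  "mv_normal p \<Omega> = density (Pi\<^sub>M {..<p} (\<lambda>_. lborel))
     (\<lambda>x. ennreal (sqrt (Determinant.det \<Omega> / (2 * pi) ^ p) *
        exp (- (\<Sum>i<p. \<Sum>j<p. x i * \<Omega> $$ (i, j) * x j) / 2)))"

(* \<theta> = (\<beta>, \<Omega>, \<sigma>), where \<sigma> is the standard deviation of the noise *)
type_synonym param = "(nat \<Rightarrow> real) \<times> real Matrix.mat \<times> real"

(* Z i = (y i, X i), where X i is the i-th row of the design *)
type_synonym sample = "nat \<Rightarrow> real \<times> (nat \<Rightarrow> real)"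

definition sample_space :: "nat \<Rightarrow> nat \<Rightarrow> sample measure" where
  "sample_space n p = Pi\<^sub>M {..<n} (\<lambda>_. borel \<Otimes>\<^sub>M Pi\<^sub>M {..<p} (\<lambda>_. borel))"

definition observe :: "nat \<Rightarrow> nat \<Rightarrow> (nat \<Rightarrow> real) \<Rightarrow> (nat \<Rightarrow> nat \<Rightarrow> real) \<Rightarrow> (nat \<Rightarrow> real) \<Rightarrow> sample" where
  "observe n p \<beta> X \<epsilon> = (\<lambda>i\<in>{..<n}. ((\<Sum>j<p. X i j * \<beta> j) + \<epsilon> i, X i))"

(* The law of Z under \<theta>; the pair measure makes the design and the noise independent. *)
definition law :: "nat \<Rightarrow> nat \<Rightarrow> param \<Rightarrow> sample measure" where
  "law n p = (\<lambda>(\<beta>, \<Omega>, \<sigma>).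
     distr (Pi\<^sub>M {..<n} (\<lambda>_. mv_normal p \<Omega>) \<Otimes>\<^sub>M
            Pi\<^sub>M {..<n} (\<lambda>_. density lborel (\<lambda>x. ennreal (normal_density 0 \<sigma> x))))
       (sample_space n p) (\<lambda>(X, \<epsilon>). observe n p \<beta> X \<epsilon>))"

definition param_known :: "nat \<Rightarrow> nat \<Rightarrow> real \<Rightarrow> param set" where
  "param_known p k \<sigma>\<^sub>0 = {(\<beta>, 1\<^sub>m p, \<sigma>\<^sub>0) | \<beta>. \<beta> \<in> {..<p} \<rightarrow>\<^sub>E UNIV \<and> l0_norm p \<beta> \<le> k}"

definition loadings :: "nat \<Rightarrow> nat \<Rightarrow> real \<Rightarrow> (nat \<Rightarrow> real) set" where
  "loadings p q cbar = {\<xi> \<in> {..<p} \<rightarrow>\<^sub>E UNIV. l0_norm p \<xi> = q \<and> \<xi> \<noteq> (\<lambda>j\<in>{..<p}. 0) \<and>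
     (MAX j\<in>vec_supp p \<xi>. \<bar>\<xi> j\<bar>) \<le> cbar * (MIN j\<in>vec_supp p \<xi>. \<bar>\<xi> j\<bar>)}"

(* l \<le> u is required because [l(Z), u(Z)] is an interval of length u(Z) - l(Z); otherwise
   negative lengths would be allowed.  T is a functional of \<beta> = fst \<theta>. *)
definition conf_intervals ::
  "nat \<Rightarrow> nat \<Rightarrow> real \<Rightarrow> param set \<Rightarrow> ((nat \<Rightarrow> real) \<Rightarrow> real) \<Rightarrow> ((sample \<Rightarrow> real) \<times> (sample \<Rightarrow> real)) set" where
  "conf_intervals n p \<alpha> \<Theta> T = {(l, u).
     l \<in> borel_measurable (sample_space n p) \<and>
     u \<in> borel_measurable (sample_space n p) \<and>
     (\<forall>z\<in>space (sample_space n p). l z \<le> u z) \<and>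
     (INF \<theta>\<in>\<Theta>. emeasure (law n p \<theta>)
        {z \<in> space (sample_space n p). l z \<le> T (fst \<theta>) \<and> T (fst \<theta>) \<le> u z}) \<ge> ennreal (1 - \<alpha>)}"

(* Values in ennreal, as an expected length may be infinite. *)
definition expected_length ::
  "nat \<Rightarrow> nat \<Rightarrow> param \<Rightarrow> (sample \<Rightarrow> real) \<times> (sample \<Rightarrow> real) \<Rightarrow> ennreal" where
  "expected_length n p \<theta> = (\<lambda>(l, u). \<integral>\<^sup>+ z. ennreal (u z - l z) \<partial>law n p \<theta>)"

definition minimax_length ::
  "nat \<Rightarrow> nat \<Rightarrow> real \<Rightarrow> param set \<Rightarrow> ((nat \<Rightarrow> real) \<Rightarrow> real) \<Rightarrow> ennreal" where
  "minimax_length n p \<alpha> \<Theta> T =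
     (INF CI\<in>conf_intervals n p \<alpha> \<Theta> T. SUP \<theta>\<in>\<Theta>. expected_length n p \<theta> CI)"

end

theory Submission
  imports Defs
begin

text \<open>Lower bound. Compare \<beta> = 0 with a multiple of the restriction of \<xi> to at most k coordinates of its
support, scaled to Euclidean norm of order \<sigma> / \<surd>n. The chi-square divergence of the two sample laws is
then small, so an interval that covers both values of the functional with probability 1 - \<alpha> must, under
\<beta> = 0, contain both with probability bounded below; its expected length is then at least a constant
times their distance. In the sparse loading regime q \<le> C k with comparable entries, a k-sparse
part of \<xi> carries a fixed fraction of the squared norm of \<xi>, so that distance is of order
|\<xi>| / \<surd>n (\<open>loadings_sparse_part\<close>, \<open>minimax_length_ge_two_point\<close>).

Upper bound. Split the sample in two halves. The first half gives a pilot vector b, and the second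
half corrects its bias: since the covariance of the design is the identity, the product
(x . \<xi>) (y - x . b) has expectation \<xi> . (\<beta> - b), and its variance is at most
a constant times |\<xi>|^2 (1 + |\<beta> - b|^4). Averaging over the second half and applying
Chebyshev's inequality gives an interval of fixed width of order |\<xi>| / \<surd>n, as soon as the pilot
has bounded error (\<open>debiased_deviation\<close>, \<open>sample_split_coverage\<close>).

Bounded error is a weak demand, so a crude pilot is enough: the first k-sparse rational vector whose
residual sum of squares is O(n). Such a vector exists because rational vectors approximate
\<beta>. Its difference to \<beta> is 2k-sparse and is mapped by the design to a vector of squared length
O(n), so it suffices that the design shrinks no 2k-sparse vector v below a constant times \<surd>n |v|
(\<open>restricted_lower_isometry\<close>). For a fixed v this fails with exponentially small probability by a
Chernoff bound (\<open>small_ball_fixed_direction\<close>); rounding entries to multiples of 1/p^2 leaves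
p^O(k) vectors, and k ln p \<le> c n pays for the union bound.\<close>

section \<open>Products of densities\<close>

text \<open>Used twice: for N(0, I) as a product of one-dimensional laws, and for the likelihood ratio of a
whole sample as the product of the ratios of its observations.\<close>

lemma PiM_density:
  fixes M :: "'i \<Rightarrow> 'a measure"
  assumes fin: "finite I" and M: "\<And>i. sigma_finite_measure (M i)"
    and f [measurable]: "\<And>i. f i \<in> borel_measurable (M i)"
    and D: "\<And>i. sigma_finite_measure (density (M i) (f i))"
  shows "Pi\<^sub>M I (\<lambda>i. density (M i) (f i)) = density (Pi\<^sub>M I M) (\<lambda>x. \<Prod>i\<in>I. f i (x i))"
proof -
  interpret M: product_sigma_finite M by (rule product_sigma_finite.intro[OF M])
  interpret D: product_sigma_finite "\<lambda>i. density (M i) (f i)" by (rule product_sigma_finite.intro[OF D])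
  have meas: "(\<lambda>x. \<Prod>i\<in>I. f i (x i)) \<in> borel_measurable (Pi\<^sub>M I M)"
    by measurable
  show ?thesis
  proof (rule D.PiM_eqI[symmetric, OF fin])
    show "sets (density (Pi\<^sub>M I M) (\<lambda>x. \<Prod>i\<in>I. f i (x i))) = sets (Pi\<^sub>M I (\<lambda>i. density (M i) (f i)))"
      by (auto intro!: sets_PiM_cong)
    fix A assume "\<And>i. i \<in> I \<Longrightarrow> A i \<in> sets (density (M i) (f i))"
    then have A: "\<And>i. i \<in> I \<Longrightarrow> A i \<in> sets (M i)" by simp
    have PA: "Pi\<^sub>E I A \<in> sets (Pi\<^sub>M I M)" by (intro sets_PiM_I_finite fin A)
    have "emeasure (density (Pi\<^sub>M I M) (\<lambda>x. \<Prod>i\<in>I. f i (x i))) (Pi\<^sub>E I A)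
        = (\<integral>\<^sup>+x. (\<Prod>i\<in>I. f i (x i)) * indicator (Pi\<^sub>E I A) x \<partial>Pi\<^sub>M I M)"
      by (rule emeasure_density[OF meas PA])
    also have "\<dots> = (\<integral>\<^sup>+x. (\<Prod>i\<in>I. f i (x i) * indicator (A i) (x i)) \<partial>Pi\<^sub>M I M)"
    proof (rule nn_integral_cong)
      fix x assume "x \<in> space (Pi\<^sub>M I M)"
      then have "(indicator (Pi\<^sub>E I A) x :: ennreal) = (\<Prod>i\<in>I. indicator (A i) (x i))"
        using fin by (auto simp: space_PiM indicator_def PiE_iff)
      then show "(\<Prod>i\<in>I. f i (x i)) * indicator (Pi\<^sub>E I A) x = (\<Prod>i\<in>I. f i (x i) * indicator (A i) (x i))"
        by (simp add: prod.distrib)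
    qed
    also have "\<dots> = (\<Prod>i\<in>I. \<integral>\<^sup>+x. f i x * indicator (A i) x \<partial>M i)"
      by (intro M.product_nn_integral_prod fin borel_measurable_times_ennreal f borel_measurable_indicator A)
    also have "\<dots> = (\<Prod>i\<in>I. emeasure (density (M i) (f i)) (A i))"
      using A by (intro prod.cong) (auto simp: emeasure_density)
    finally show "emeasure (density (Pi\<^sub>M I M) (\<lambda>x. \<Prod>i\<in>I. f i (x i))) (Pi\<^sub>E I A)
        = (\<Prod>i\<in>I. emeasure (density (M i) (f i)) (A i))" .
  qed
qed

section \<open>The law of one observation\<close>

definition noise :: "real \<Rightarrow> real measure" where
  "noise \<sigma> = density lborel (\<lambda>x. ennreal (normal_density 0 \<sigma> x))"

definition std_normal_vec :: "nat \<Rightarrow> (nat \<Rightarrow> real) measure" where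
  "std_normal_vec p = Pi\<^sub>M {..<p} (\<lambda>_. noise 1)"

abbreviation row_space :: "nat \<Rightarrow> (real \<times> (nat \<Rightarrow> real)) measure" where
  "row_space p \<equiv> borel \<Otimes>\<^sub>M Pi\<^sub>M {..<p} (\<lambda>_. borel)"

text \<open>The response comes first, as in the sample; x and e are the independent design row and noise.\<close>

definition row_law :: "nat \<Rightarrow> (nat \<Rightarrow> real) \<Rightarrow> real \<Rightarrow> (real \<times> (nat \<Rightarrow> real)) measure" where
  "row_law p \<beta> \<sigma> = distr (std_normal_vec p \<Otimes>\<^sub>M noise \<sigma>) (row_space p) (\<lambda>(x, e). (lin_fun p x \<beta> + e, x))"

lemma sets_noise [measurable_cong, simp]: "sets (noise \<sigma>) = sets borel"
  by (simp add: noise_def)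

lemma space_noise [simp]: "space (noise \<sigma>) = UNIV"
  by (simp add: noise_def)

lemma sets_std_normal_vec [measurable_cong, simp]:
  "sets (std_normal_vec p) = sets (Pi\<^sub>M {..<p} (\<lambda>_. borel))"
  unfolding std_normal_vec_def by (rule sets_PiM_cong) auto

lemma sets_row_law [measurable_cong, simp]: "sets (row_law p \<beta> \<sigma>) = sets (row_space p)"
  by (simp add: row_law_def)

lemma prob_space_noise: "\<sigma> > 0 \<Longrightarrow> prob_space (noise \<sigma>)"
  unfolding noise_def by (rule prob_space_normal_density)

lemma prob_space_std_normal_vec: "prob_space (std_normal_vec p)"
  unfolding std_normal_vec_def by (intro prob_space_PiM prob_space_noise) simp

lemma measurable_lin_fun [measurable]: "(\<lambda>x. lin_fun p x v) \<in> borel_measurable (Pi\<^sub>M {..<p} (\<lambda>_. borel))"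
  unfolding lin_fun_def by measurable

lemma prob_space_pair_row: "\<sigma> > 0 \<Longrightarrow> prob_space (std_normal_vec p \<Otimes>\<^sub>M noise \<sigma>)"
  by (intro prob_space_pair prob_space_std_normal_vec prob_space_noise)

lemma prob_space_row_law: "\<sigma> > 0 \<Longrightarrow> prob_space (row_law p \<beta> \<sigma>)"
  unfolding row_law_def by (rule prob_space.prob_space_distr[OF prob_space_pair_row]) measurable

lemma mv_normal_one: "mv_normal p (1\<^sub>m p) = std_normal_vec p"
proof -
  have sf: "sigma_finite_measure (density lborel (\<lambda>x. ennreal (std_normal_density x)))"
    by (intro prob_space_imp_sigma_finite prob_space_normal_density) simp
  have "std_normal_vec p = density (Pi\<^sub>M {..<p} (\<lambda>_. lborel)) (\<lambda>x. \<Prod>i<p. ennreal (std_normal_density (x i)))"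
    unfolding std_normal_vec_def noise_def
    by (rule PiM_density[OF _ lborel.sigma_finite_measure_axioms _ sf]) simp_all
  also have "(\<lambda>x. \<Prod>i<p. ennreal (std_normal_density (x i))) =
     (\<lambda>x. ennreal (sqrt (Determinant.det (1\<^sub>m p) / (2 * pi) ^ p) *
        exp (- (\<Sum>i<p. \<Sum>j<p. x i * (1\<^sub>m p) $$ (i, j) * x j) / 2)))"
  proof
    fix x :: "nat \<Rightarrow> real"
    have row: "(\<Sum>j<p. x i * (1\<^sub>m p) $$ (i, j) * x j) = (x i)\<^sup>2" if i: "i < p" for i
    proof -
      have "(\<Sum>j<p. x i * (1\<^sub>m p) $$ (i, j) * x j) = (\<Sum>j<p. if i = j then (x i)\<^sup>2 else 0)"
        using i by (intro sum.cong) (auto simp: power2_eq_square)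
      also have "\<dots> = (x i)\<^sup>2" using i by simp
      finally show ?thesis .
    qed
    have quad: "- (\<Sum>i<p. \<Sum>j<p. x i * (1\<^sub>m p) $$ (i, j) * x j) / 2 = (\<Sum>i<p. - (x i)\<^sup>2 / 2)"
    proof -
      have "(\<Sum>i<p. \<Sum>j<p. x i * (1\<^sub>m p) $$ (i, j) * x j) = (\<Sum>i<p. (x i)\<^sup>2)"
        by (intro sum.cong row) auto
      then show ?thesis
        by (simp only: sum_divide_distrib sum_negf[symmetric])
    qed
    have "sqrt (Determinant.det (1\<^sub>m p) / (2 * pi) ^ p) = (\<Prod>i<p. 1 / sqrt (2 * pi))"
      by (simp only: det_one real_sqrt_divide real_sqrt_power real_sqrt_one prod_constant card_lessThan power_one_over)
    then have "sqrt (Determinant.det (1\<^sub>m p) / (2 * pi) ^ p) *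
        exp (- (\<Sum>i<p. \<Sum>j<p. x i * (1\<^sub>m p) $$ (i, j) * x j) / 2) =
        (\<Prod>i<p. std_normal_density (x i))"
      unfolding quad by (simp only: exp_sum finite_lessThan prod.distrib[symmetric] std_normal_density_def)
    then show "(\<Prod>i<p. ennreal (std_normal_density (x i))) = ennreal (sqrt (Determinant.det (1\<^sub>m p) / (2 * pi) ^ p) *
        exp (- (\<Sum>i<p. \<Sum>j<p. x i * (1\<^sub>m p) $$ (i, j) * x j) / 2))"
      by (simp add: prod_ennreal)
  qed
  finally show ?thesis by (simp add: mv_normal_def)
qed

lemma measurable_observe:
  "(\<lambda>(X, \<epsilon>). observe n p \<beta> X \<epsilon>) \<in>
     Pi\<^sub>M {..<n} (\<lambda>_. Pi\<^sub>M {..<p} (\<lambda>_. borel)) \<Otimes>\<^sub>M Pi\<^sub>M {..<n} (\<lambda>_. borel) \<rightarrow>\<^sub>M sample_space n p"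
  unfolding observe_def sample_space_def split_def
proof (intro measurable_restrict measurable_Pair)
  let ?M = "Pi\<^sub>M {..<n} (\<lambda>_. Pi\<^sub>M {..<p} (\<lambda>_. borel)) \<Otimes>\<^sub>M Pi\<^sub>M {..<n} (\<lambda>_. borel) :: ((nat \<Rightarrow> nat \<Rightarrow> real) \<times> (nat \<Rightarrow> real)) measure"
  fix i assume i: "i \<in> {..<n}"
  show X: "(\<lambda>w. fst w i) \<in> ?M \<rightarrow>\<^sub>M Pi\<^sub>M {..<p} (\<lambda>_. borel)"
    by (rule measurable_compose[OF measurable_fst measurable_component_singleton[OF i]])
  have Xj: "(\<lambda>w. fst w i j) \<in> borel_measurable ?M" if "j \<in> {..<p}" for j
    by (rule measurable_compose[OF X measurable_component_singleton[OF that]])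
  have sum: "(\<lambda>w. \<Sum>j<p. fst w i j * \<beta> j) \<in> borel_measurable ?M"
    by (rule borel_measurable_sum, rule borel_measurable_times[OF Xj borel_measurable_const])
  have "(\<lambda>w. snd w i) \<in> borel_measurable ?M"
    by (rule measurable_compose[OF measurable_snd measurable_component_singleton[OF i]])
  with sum show "(\<lambda>w. (\<Sum>j<p. fst w i j * \<beta> j) + snd w i) \<in> borel_measurable ?M"
    by (rule borel_measurable_add)
qed

text \<open>The model draws the whole design and, independently, the whole noise vector. Regrouped by
observation, it is an i.i.d. product: this is the form needed for splitting the sample and for
factorising exponential moments and likelihood ratios. The two measures agree on boxes by Fubini's theorem.\<close>

lemma law_eq_PiM:
  assumes \<sigma>: "\<sigma> > 0"
  shows "law n p (\<beta>, 1\<^sub>m p, \<sigma>) = Pi\<^sub>M {..<n} (\<lambda>_. row_law p \<beta> \<sigma>)"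
proof -
  interpret N: prob_space "std_normal_vec p" by (rule prob_space_std_normal_vec)
  interpret E: prob_space "noise \<sigma>" by (rule prob_space_noise[OF \<sigma>])
  interpret R: prob_space "row_law p \<beta> \<sigma>" by (rule prob_space_row_law[OF \<sigma>])
  interpret NN: product_sigma_finite "\<lambda>_::nat. std_normal_vec p" ..
  interpret EE: product_sigma_finite "\<lambda>_::nat. noise \<sigma>" ..
  interpret RR: product_sigma_finite "\<lambda>_::nat. row_law p \<beta> \<sigma>" ..
  let ?X = "Pi\<^sub>M {..<n} (\<lambda>_. std_normal_vec p)" and ?E = "Pi\<^sub>M {..<n} (\<lambda>_. noise \<sigma>)"
  interpret X: prob_space ?X by (intro prob_space_PiM N.prob_space_axioms)
  interpret EP: prob_space ?E by (intro prob_space_PiM E.prob_space_axioms)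
  have sX [measurable_cong]: "sets ?X = sets (Pi\<^sub>M {..<n} (\<lambda>_. Pi\<^sub>M {..<p} (\<lambda>_. borel)))"
    and sE [measurable_cong]: "sets ?E = sets (Pi\<^sub>M {..<n} (\<lambda>_. borel))"
    by (intro sets_PiM_cong; simp)+
  have sP: "sets (?X \<Otimes>\<^sub>M ?E) = sets (Pi\<^sub>M {..<n} (\<lambda>_. Pi\<^sub>M {..<p} (\<lambda>_. borel)) \<Otimes>\<^sub>M Pi\<^sub>M {..<n} (\<lambda>_. borel))"
    by (intro sets_pair_measure_cong sX sE)
  have obs [measurable]: "(\<lambda>(X, \<epsilon>). observe n p \<beta> X \<epsilon>) \<in> ?X \<Otimes>\<^sub>M ?E \<rightarrow>\<^sub>M sample_space n p"
    using measurable_observe by (subst measurable_cong_sets[OF sP refl])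
  have law: "law n p (\<beta>, 1\<^sub>m p, \<sigma>) = distr (?X \<Otimes>\<^sub>M ?E) (sample_space n p) (\<lambda>(X, \<epsilon>). observe n p \<beta> X \<epsilon>)"
    by (simp add: law_def mv_normal_one noise_def)
  show ?thesis unfolding law
  proof (rule RR.PiM_eqI)
    show "sets (distr (?X \<Otimes>\<^sub>M ?E) (sample_space n p) (\<lambda>(X, \<epsilon>). observe n p \<beta> X \<epsilon>)) = sets (Pi\<^sub>M {..<n} (\<lambda>_. row_law p \<beta> \<sigma>))"
      by (simp add: sample_space_def cong: sets_PiM_cong)
    fix A assume "\<And>i. i \<in> {..<n} \<Longrightarrow> A i \<in> sets (row_law p \<beta> \<sigma>)"
    then have A: "\<And>i. i \<in> {..<n} \<Longrightarrow> A i \<in> sets (row_space p)" by simp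
    have PA: "Pi\<^sub>E {..<n} A \<in> sets (sample_space n p)"
      unfolding sample_space_def by (intro sets_PiM_I_finite A) auto
    define h where "h = (\<lambda>(x, e). (lin_fun p x \<beta> + e, x))"
    have h: "h \<in> std_normal_vec p \<Otimes>\<^sub>M noise \<sigma> \<rightarrow>\<^sub>M row_space p"
      unfolding h_def by measurable
    define g :: "nat \<Rightarrow> (nat \<Rightarrow> real) \<times> real \<Rightarrow> ennreal" where "g i w = indicator (A i) (h w)" for i w
    have ind: "indicator (Pi\<^sub>E {..<n} A) (observe n p \<beta> X e) = (\<Prod>i<n. g i (X i, e i))" for X e
      by (auto simp: indicator_def observe_def lin_fun_def PiE_iff g_def h_def)
    have gm: "g i \<in> borel_measurable (std_normal_vec p \<Otimes>\<^sub>M noise \<sigma>)" if "i \<in> {..<n}" for i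
      unfolding g_def by (rule measurable_compose[OF h borel_measurable_indicator[OF A[OF that]]])
    have gm2: "(\<lambda>e. g i (x, e)) \<in> borel_measurable (noise \<sigma>)" if "i \<in> {..<n}" "x \<in> space (std_normal_vec p)" for i x
      by (rule measurable_compose[OF measurable_Pair1'[OF that(2)] gm[OF that(1)]])
    have "emeasure (distr (?X \<Otimes>\<^sub>M ?E) (sample_space n p) (\<lambda>(X, \<epsilon>). observe n p \<beta> X \<epsilon>)) (Pi\<^sub>E {..<n} A)
      = (\<integral>\<^sup>+z. indicator (Pi\<^sub>E {..<n} A) z \<partial>distr (?X \<Otimes>\<^sub>M ?E) (sample_space n p) (\<lambda>(X, \<epsilon>). observe n p \<beta> X \<epsilon>))"
      using PA by simp
    also have "\<dots> = (\<integral>\<^sup>+w. indicator (Pi\<^sub>E {..<n} A) (case w of (X, \<epsilon>) \<Rightarrow> observe n p \<beta> X \<epsilon>) \<partial>(?X \<Otimes>\<^sub>M ?E))"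
      using PA by (intro nn_integral_distr[OF obs]) auto
    also have "\<dots> = (\<integral>\<^sup>+X. \<integral>\<^sup>+e. indicator (Pi\<^sub>E {..<n} A) (observe n p \<beta> X e) \<partial>?E \<partial>?X)"
    proof (subst EP.nn_integral_fst[symmetric])
      show "(\<lambda>w. indicator (Pi\<^sub>E {..<n} A) (case w of (X, \<epsilon>) \<Rightarrow> observe n p \<beta> X \<epsilon>) :: ennreal) \<in> borel_measurable (?X \<Otimes>\<^sub>M ?E)"
        using PA by (intro measurable_compose[OF obs]) auto
    qed simp
    also have "\<dots> = (\<integral>\<^sup>+X. (\<Prod>i<n. \<integral>\<^sup>+e. g i (X i, e) \<partial>noise \<sigma>) \<partial>?X)"
    proof (rule nn_integral_cong)
      fix X assume "X \<in> space ?X"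
      then have "X i \<in> space (std_normal_vec p)" if "i \<in> {..<n}" for i
        using that by (auto simp: space_PiM)
      then show "(\<integral>\<^sup>+e. indicator (Pi\<^sub>E {..<n} A) (observe n p \<beta> X e) \<partial>?E) = (\<Prod>i<n. \<integral>\<^sup>+e. g i (X i, e) \<partial>noise \<sigma>)"
        unfolding ind
        by (intro EE.product_nn_integral_prod[where f="\<lambda>i e. g i (X i, e)"] finite_lessThan gm2)
    qed
    also have "\<dots> = (\<Prod>i<n. \<integral>\<^sup>+x. \<integral>\<^sup>+e. g i (x, e) \<partial>noise \<sigma> \<partial>std_normal_vec p)"
      by (intro NN.product_nn_integral_prod[where f="\<lambda>i x. \<integral>\<^sup>+e. g i (x, e) \<partial>noise \<sigma>"] E.borel_measurable_nn_integral_fst gm finite_lessThan)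
    also have "\<dots> = (\<Prod>i<n. emeasure (row_law p \<beta> \<sigma>) (A i))"
    proof (rule prod.cong)
      fix i assume i: "i \<in> {..<n}"
      have "(\<integral>\<^sup>+x. \<integral>\<^sup>+e. g i (x, e) \<partial>noise \<sigma> \<partial>std_normal_vec p) = (\<integral>\<^sup>+w. g i w \<partial>(std_normal_vec p \<Otimes>\<^sub>M noise \<sigma>))"
        by (rule E.nn_integral_fst[OF gm[OF i]])
      also have "\<dots> = (\<integral>\<^sup>+w. indicator (A i) w \<partial>row_law p \<beta> \<sigma>)"
        unfolding row_law_def g_def h_def[symmetric]
        using A[OF i] by (intro nn_integral_distr[OF h, symmetric] borel_measurable_indicator) simp
      also have "\<dots> = emeasure (row_law p \<beta> \<sigma>) (A i)" using A[OF i] by simp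
      finally show "(\<integral>\<^sup>+x. \<integral>\<^sup>+e. g i (x, e) \<partial>noise \<sigma> \<partial>std_normal_vec p) = emeasure (row_law p \<beta> \<sigma>) (A i)" .
    qed simp
    finally show "emeasure (distr (?X \<Otimes>\<^sub>M ?E) (sample_space n p) (\<lambda>(X, \<epsilon>). observe n p \<beta> X \<epsilon>)) (Pi\<^sub>E {..<n} A)
      = (\<Prod>i<n. emeasure (row_law p \<beta> \<sigma>) (A i))" .
  qed simp
qed

section \<open>Gaussian linear forms\<close>

definition sqnorm :: "nat \<Rightarrow> (nat \<Rightarrow> real) \<Rightarrow> real" where
  "sqnorm p v = (\<Sum>j<p. (v j)\<^sup>2)"

lemma sqnorm_nonneg [simp]: "0 \<le> sqnorm p v"
  by (simp add: sqnorm_def sum_nonneg)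

lemma L2_set_eq_sqrt_sqnorm: "L2_set v {..<p} = sqrt (sqnorm p v)"
  by (simp add: L2_set_def sqnorm_def)

lemma sqnorm_eq_0D: "sqnorm p v = 0 \<Longrightarrow> j < p \<Longrightarrow> v j = 0"
  by (simp add: sqnorm_def sum_nonneg_eq_0_iff)

lemma indep_vars_PiM_components:
  assumes I: "I \<noteq> {}" and M: "\<And>i. i \<in> I \<Longrightarrow> prob_space (M i)"
  shows "prob_space.indep_vars (Pi\<^sub>M I M) M (\<lambda>i x. x i) I"
proof -
  interpret prob_space "Pi\<^sub>M I M" by (rule prob_space_PiM[OF M])
  have "distr (Pi\<^sub>M I M) (Pi\<^sub>M I M) (\<lambda>x. \<lambda>i\<in>I. x i) = distr (Pi\<^sub>M I M) (Pi\<^sub>M I M) (\<lambda>x. x)"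
    by (rule distr_cong) (auto simp: space_PiM PiE_iff extensional_restrict)
  also have "\<dots> = Pi\<^sub>M I M" by (rule distr_id)
  also have "\<dots> = Pi\<^sub>M I (\<lambda>i. distr (Pi\<^sub>M I M) (M i) (\<lambda>x. x i))"
    using M by (intro PiM_cong distr_PiM_component[symmetric]) auto
  finally show ?thesis
    using I by (subst indep_vars_iff_distr_eq_PiM') simp_all
qed

lemma coordinate_distributed_std_normal:
  assumes "i < p"
  shows "distributed (std_normal_vec p) lborel (\<lambda>x. x i) (\<lambda>x. ennreal (std_normal_density x))"
  unfolding distributed_def
proof (intro conjI)
  have "distr (Pi\<^sub>M {..<p} (\<lambda>_. noise 1)) (noise 1) (\<lambda>x. x i) = noise 1"
    using assms by (intro distr_PiM_component prob_space_noise) auto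
  moreover have "distr (Pi\<^sub>M {..<p} (\<lambda>_. noise 1)) (noise 1) (\<lambda>x. x i)
      = distr (Pi\<^sub>M {..<p} (\<lambda>_. noise 1)) lborel (\<lambda>x. x i)"
    by (rule distr_cong) simp_all
  ultimately show "distr (std_normal_vec p) lborel (\<lambda>x. x i) = density lborel (\<lambda>x. ennreal (std_normal_density x))"
    by (simp add: std_normal_vec_def noise_def)
  have "(\<lambda>x. x i) \<in> Pi\<^sub>M {..<p} (\<lambda>_. borel) \<rightarrow>\<^sub>M (borel :: real measure)"
    using assms by (intro measurable_component_singleton) simp
  then show "(\<lambda>x. x i) \<in> std_normal_vec p \<rightarrow>\<^sub>M lborel"
    by (subst measurable_cong_sets[OF sets_std_normal_vec sets_lborel])
qed simp

lemma indep_coordinates: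
  assumes "I \<noteq> {}" "I \<subseteq> {..<p}"
  shows "prob_space.indep_vars (std_normal_vec p) (\<lambda>_. borel) (\<lambda>i x. x i) I"
proof -
  interpret prob_space "std_normal_vec p" by (rule prob_space_std_normal_vec)
  have "indep_vars (\<lambda>_. noise 1) (\<lambda>i x. x i) {..<p}"
    unfolding std_normal_vec_def
    using assms by (intro indep_vars_PiM_components prob_space_noise) auto
  then have "indep_vars (\<lambda>_. borel) (\<lambda>i x. x i) {..<p}"
    by (rule indep_vars_compose2[where Y="\<lambda>_ t. t" and N="\<lambda>_. borel"]) (rule measurable_ident_sets[OF sets_noise])
  then show ?thesis
    using assms(2) by (rule indep_vars_subset)
qed

text \<open>The sum is taken over the support of v only, because the convolution theorem for normal laws
asks for positive variances.\<close>

lemma lin_fun_distributed_normal: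
  assumes v: "sqnorm p v > 0"
  shows "distributed (std_normal_vec p) lborel (\<lambda>x. lin_fun p x v)
    (\<lambda>t. ennreal (normal_density 0 (sqrt (sqnorm p v)) t))"
proof -
  interpret prob_space "std_normal_vec p" by (rule prob_space_std_normal_vec)
  let ?S = "{j\<in>{..<p}. v j \<noteq> 0}"
  have ne: "?S \<noteq> {}"
    using v by (auto simp: sqnorm_def dest!: less_imp_neq intro: ccontr)
  have sum: "lin_fun p x v = (\<Sum>j\<in>?S. x j * v j)" for x
    unfolding lin_fun_def by (rule sum.mono_neutral_right) auto
  have sq: "sqnorm p v = (\<Sum>j\<in>?S. \<bar>v j\<bar>\<^sup>2)"
    unfolding sqnorm_def by (subst sum.mono_neutral_right[of _ ?S]) auto
  have "indep_vars (\<lambda>_. borel) (\<lambda>j x. x j) ?S" using ne by (intro indep_coordinates) auto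
  then have indep: "indep_vars (\<lambda>_. borel) (\<lambda>j x. x j * v j) ?S"
    by (rule indep_vars_compose2[where Y="\<lambda>j t. t * v j" and N="\<lambda>_. borel"]) simp
  have "distributed (std_normal_vec p) lborel (\<lambda>x. \<Sum>j\<in>?S. x j * v j)
      (normal_density (\<Sum>j\<in>?S. 0) (sqrt (\<Sum>j\<in>?S. \<bar>v j\<bar>\<^sup>2)))"
  proof (rule sum_indep_normal[OF _ ne indep])
    fix j assume j: "j \<in> ?S"
    then have "distributed (std_normal_vec p) lborel (\<lambda>x. 0 + v j * x j) (normal_density (0 + v j * 0) (\<bar>v j\<bar> * 1))"
      by (intro normal_density_affine coordinate_distributed_std_normal) auto
    then show "distributed (std_normal_vec p) lborel (\<lambda>x. x j * v j) (normal_density 0 \<bar>v j\<bar>)"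
      by (simp add: mult.commute)
  qed auto
  then show ?thesis by (simp add: sum sq)
qed

lemma lin_fun_eq_0: "sqnorm p v = 0 \<Longrightarrow> lin_fun p x v = 0"
  by (simp add: lin_fun_def sqnorm_eq_0D)

text \<open>Multiplying a centred normal density by exp (s t^2) gives, up to the factor 1 / sqrt d with
d = 1 - 2 s \<tau>^2, the centred normal density of standard deviation \<tau> / sqrt d. Negative s yields
the small ball bound for the design, positive s the chi-square divergence of the lower bound.\<close>

lemma normal_exp_square:
  assumes "\<tau> > 0" "2 * s * \<tau>\<^sup>2 < 1"
  shows "(\<integral>\<^sup>+t. ennreal (normal_density 0 \<tau> t) * ennreal (exp (s * t\<^sup>2)) \<partial>lborel) = ennreal (1 / sqrt (1 - 2 * s * \<tau>\<^sup>2))"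
proof -
  define d where "d = 1 - 2 * s * \<tau>\<^sup>2"
  have d: "d > 0" using assms by (simp add: d_def)
  let ?\<rho> = "\<tau> / sqrt d"
  have \<rho>: "?\<rho> > 0" using assms d by simp
  have eq: "normal_density 0 \<tau> t * exp (s * t\<^sup>2) = 1 / sqrt d * normal_density 0 ?\<rho> t" for t
  proof -
    have "- t\<^sup>2 / (2 * \<tau>\<^sup>2) + s * t\<^sup>2 = - t\<^sup>2 / (2 * ?\<rho>\<^sup>2)"
      using assms d unfolding power_divide by (simp add: field_simps) (simp add: d_def algebra_simps)
    then have e: "exp (- t\<^sup>2 / (2 * \<tau>\<^sup>2)) * exp (s * t\<^sup>2) = exp (- t\<^sup>2 / (2 * ?\<rho>\<^sup>2))"
      by (simp only: exp_add[symmetric])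
    have "sqrt (2 * pi * ?\<rho>\<^sup>2) = sqrt (2 * pi * \<tau>\<^sup>2) / sqrt d"
      using d by (simp add: power_divide real_sqrt_divide real_sqrt_mult)
    then have c: "1 / sqrt (2 * pi * \<tau>\<^sup>2) = 1 / sqrt d * (1 / sqrt (2 * pi * ?\<rho>\<^sup>2))"
      using d by simp
    have "normal_density 0 \<tau> t * exp (s * t\<^sup>2)
        = 1 / sqrt (2 * pi * \<tau>\<^sup>2) * (exp (- t\<^sup>2 / (2 * \<tau>\<^sup>2)) * exp (s * t\<^sup>2))"
      by (simp add: normal_density_def)
    also have "\<dots> = 1 / sqrt d * normal_density 0 ?\<rho> t"
      unfolding e c by (simp add: normal_density_def)
    finally show ?thesis .
  qed
  have "(\<integral>\<^sup>+t. ennreal (normal_density 0 \<tau> t) * ennreal (exp (s * t\<^sup>2)) \<partial>lborel)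
      = (\<integral>\<^sup>+t. ennreal (1 / sqrt d) * ennreal (normal_density 0 ?\<rho> t) \<partial>lborel)"
    using d by (intro nn_integral_cong) (simp add: ennreal_mult''[symmetric] ennreal_mult'[symmetric] eq)
  also have "\<dots> = ennreal (1 / sqrt d)"
    using \<rho> by (simp add: nn_integral_cmult nn_integral_eq_integral)
  finally show ?thesis by (simp add: d_def)
qed

lemma nn_integral_exp_square_lin_fun:
  assumes "2 * s * sqnorm p v < 1"
  shows "(\<integral>\<^sup>+x. ennreal (exp (s * (lin_fun p x v)\<^sup>2)) \<partial>std_normal_vec p) = ennreal (1 / sqrt (1 - 2 * s * sqnorm p v))"
proof (cases "sqnorm p v = 0")
  case True
  interpret prob_space "std_normal_vec p" by (rule prob_space_std_normal_vec)
  show ?thesis using True by (simp add: lin_fun_eq_0 emeasure_space_1)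
next
  case False
  then have pos: "sqnorm p v > 0" using sqnorm_nonneg[of p v] by linarith
  have "(\<integral>\<^sup>+x. ennreal (exp (s * (lin_fun p x v)\<^sup>2)) \<partial>std_normal_vec p)
      = (\<integral>\<^sup>+t. ennreal (normal_density 0 (sqrt (sqnorm p v)) t) * ennreal (exp (s * t\<^sup>2)) \<partial>lborel)"
    by (rule distributed_nn_integral[OF lin_fun_distributed_normal[OF pos], symmetric]) simp
  also have "\<dots> = ennreal (1 / sqrt (1 - 2 * s * sqnorm p v))"
    using normal_exp_square[of "sqrt (sqnorm p v)" s] assms pos by simp
  finally show ?thesis .
qed

lemma has_bochner_integral_lin_fun_even_power:
  shows "has_bochner_integral (std_normal_vec p) (\<lambda>x. (lin_fun p x v) ^ (2 * k)) (fact (2 * k) / (2 ^ k * fact k) * sqnorm p v ^ k)"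
proof (cases "sqnorm p v = 0")
  case True
  interpret prob_space "std_normal_vec p" by (rule prob_space_std_normal_vec)
  show ?thesis
    using True by (cases k) (simp_all add: has_bochner_integral_iff lin_fun_eq_0 prob_space)
next
  case False
  then have pos: "sqnorm p v > 0" using sqnorm_nonneg[of p v] by linarith
  note D = lin_fun_distributed_normal[OF pos]
  note E = normal_moment_even[of "sqrt (sqnorm p v)" 0 k]
  have E': "has_bochner_integral lborel (\<lambda>t. normal_density 0 (sqrt (sqnorm p v)) t * t ^ (2 * k)) (fact (2 * k) / (2 ^ k * fact k) * sqnorm p v ^ k)"
    using E pos by (simp add: power_divide)
  show ?thesis
    using E' distributed_integrable[OF D, of "\<lambda>t. t ^ (2 * k)"] distributed_integral[OF D, of "\<lambda>t. t ^ (2 * k)"]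
    by (simp add: has_bochner_integral_iff)
qed

section \<open>Sums of independent copies\<close>

lemma has_bochner_integral_PiM_component:
  fixes f :: "'a \<Rightarrow> real"
  assumes R: "prob_space R" and i: "i \<in> J" and f: "has_bochner_integral R f c"
  shows "has_bochner_integral (Pi\<^sub>M J (\<lambda>_. R)) (\<lambda>z. f (z i)) c"
proof -
  have m: "(\<lambda>z. z i) \<in> Pi\<^sub>M J (\<lambda>_. R) \<rightarrow>\<^sub>M R"
    using i by (rule measurable_component_singleton)
  have "has_bochner_integral (distr (Pi\<^sub>M J (\<lambda>_. R)) R (\<lambda>z. z i)) f c"
    using f distr_PiM_component[of J "\<lambda>_. R" i] R i by simp
  then show ?thesis
    using f m by (simp add: has_bochner_integral_iff integrable_distr_eq integral_distr)
qed

lemma Markov_PiM_sum: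
  fixes f :: "'a \<Rightarrow> real"
  assumes R: "prob_space R" and f: "has_bochner_integral R f c" "\<And>x. 0 \<le> f x" and t: "t > 0"
  shows "measure (Pi\<^sub>M J (\<lambda>_. R)) {z \<in> space (Pi\<^sub>M J (\<lambda>_. R)). t \<le> (\<Sum>i\<in>J. f (z i))} \<le> real (card J) * c / t"
proof -
  let ?P = "Pi\<^sub>M J (\<lambda>_. R)"
  have "has_bochner_integral ?P (\<lambda>z. \<Sum>i\<in>J. f (z i)) (\<Sum>i\<in>J. c)"
    by (intro has_bochner_integral_sum has_bochner_integral_PiM_component R f)
  then have int: "integrable ?P (\<lambda>z. \<Sum>i\<in>J. f (z i))" and E: "(\<integral>z. (\<Sum>i\<in>J. f (z i)) \<partial>?P) = real (card J) * c"
    by (simp_all add: has_bochner_integral_iff)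
  have "measure ?P {z \<in> space ?P. t \<le> (\<Sum>i\<in>J. f (z i))} \<le> (\<integral>z. (\<Sum>i\<in>J. f (z i)) \<partial>?P) / t"
    using f(2) t by (intro integral_Markov_inequality_measure[OF int sets.empty_sets]) (auto intro: sum_nonneg)
  then show ?thesis by (simp only: E)
qed

text \<open>Products of distinct centred independent terms integrate to zero, so the second moment of the
sum is the number of terms times the second moment of one term.\<close>

lemma Chebyshev_PiM_sum:
  fixes g :: "'a \<Rightarrow> real"
  assumes R: "prob_space R" and J: "finite J"
    and g: "integrable R g" "integrable R (\<lambda>x. (g x)\<^sup>2)" and mean: "(\<integral>x. g x \<partial>R) = 0"
    and V: "(\<integral>x. (g x)\<^sup>2 \<partial>R) \<le> V" and t: "t > 0"
  shows "measure (Pi\<^sub>M J (\<lambda>_. R)) {z \<in> space (Pi\<^sub>M J (\<lambda>_. R)). t \<le> \<bar>\<Sum>i\<in>J. g (z i)\<bar>} \<le> real (card J) * V / t\<^sup>2"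
proof -
  let ?P = "Pi\<^sub>M J (\<lambda>_. R)"
  interpret R: prob_space R by (rule R)
  interpret product_sigma_finite "\<lambda>_. R" ..
  interpret prob_space ?P by (rule prob_space_PiM[OF R])
  have cross: "has_bochner_integral ?P (\<lambda>z. g (z i) * g (z j)) (if i = j then (\<integral>x. (g x)\<^sup>2 \<partial>R) else 0)"
    if ij: "i \<in> J" "j \<in> J" for i j
  proof -
    \<comment> \<open>the product g (z i) * g (z j), written as a product over all of J\<close>
    define f :: "_ \<Rightarrow> 'a \<Rightarrow> real" where
      "f k = (if k = i then if k = j then (\<lambda>x. (g x)\<^sup>2) else g else if k = j then g else (\<lambda>_. 1))" for k
    have int: "integrable R (f k)" for k
      using g by (simp add: f_def)
    have prod: "(\<Prod>k\<in>J. f k (z k)) = g (z i) * g (z j)" for z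
    proof (cases "i = j")
      case True
      then have "(\<Prod>k\<in>J. f k (z k)) = (\<Prod>k\<in>J. if k = i then (g (z i))\<^sup>2 else 1)"
        by (intro prod.cong) (auto simp: f_def)
      then show ?thesis using True ij J by (simp add: power2_eq_square)
    next
      case False
      have "(\<Prod>k\<in>J. f k (z k)) = (\<Prod>k\<in>{i, j}. f k (z k))"
        using ij J by (intro prod.mono_neutral_right) (auto simp: f_def)
      then show ?thesis using False by (simp add: f_def)
    qed
    have "(\<Prod>k\<in>J. integral\<^sup>L R (f k)) = (if i = j then (\<integral>x. (g x)\<^sup>2 \<partial>R) else 0)"
    proof (cases "i = j")
      case True
      then have "(\<Prod>k\<in>J. integral\<^sup>L R (f k)) = (\<Prod>k\<in>J. if k = i then (\<integral>x. (g x)\<^sup>2 \<partial>R) else 1)"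
        by (intro prod.cong) (auto simp: f_def R.prob_space)
      then show ?thesis using True ij J by simp
    next
      case False
      then have "integral\<^sup>L R (f i) = 0" by (simp add: f_def mean)
      then show ?thesis using False ij J by (auto intro!: prod_zero)
    qed
    then show ?thesis
      using product_integrable_prod[OF J, of f, OF int] product_integral_prod[OF J, of f, OF int]
      unfolding prod has_bochner_integral_iff by simp
  qed
  have sq: "(\<Sum>i\<in>J. g (z i))\<^sup>2 = (\<Sum>i\<in>J. \<Sum>j\<in>J. g (z i) * g (z j))" for z
    by (simp add: power2_eq_square sum_product)
  have "has_bochner_integral ?P (\<lambda>z. (\<Sum>i\<in>J. g (z i))\<^sup>2) (\<Sum>i\<in>J. \<Sum>j\<in>J. if i = j then (\<integral>x. (g x)\<^sup>2 \<partial>R) else 0)"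
    unfolding sq by (intro has_bochner_integral_sum cross)
  then have int2: "integrable ?P (\<lambda>z. (\<Sum>i\<in>J. g (z i))\<^sup>2)"
    and E2: "(\<integral>z. (\<Sum>i\<in>J. g (z i))\<^sup>2 \<partial>?P) = real (card J) * (\<integral>x. (g x)\<^sup>2 \<partial>R)"
    using J by (simp_all add: has_bochner_integral_iff)
  have m: "(\<lambda>z. \<Sum>i\<in>J. g (z i)) \<in> borel_measurable ?P"
    using g by (intro borel_measurable_sum measurable_compose[OF measurable_component_singleton]) auto
  have "measure ?P {z \<in> space ?P. t \<le> \<bar>\<Sum>i\<in>J. g (z i)\<bar>} \<le> (\<integral>z. (\<Sum>i\<in>J. g (z i))\<^sup>2 \<partial>?P) / t\<^sup>2"
    by (rule second_moment_method[OF m int2 t])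
  also have "\<dots> \<le> real (card J) * V / t\<^sup>2"
    unfolding E2 using V by (intro divide_right_mono mult_left_mono) auto
  finally show ?thesis .
qed

section \<open>Moments of one observation\<close>

lemma has_bochner_integral_pair_fst:
  assumes "prob_space N" "has_bochner_integral M (f :: 'a \<Rightarrow> real) c"
  shows "has_bochner_integral (M \<Otimes>\<^sub>M N) (\<lambda>w. f (fst w)) c"
proof -
  interpret prob_space N by fact
  have "has_bochner_integral (distr (M \<Otimes>\<^sub>M N) M fst) f c"
    using assms(2) by (simp add: distr_pair_fst)
  then show ?thesis
    using assms(2) by (simp add: has_bochner_integral_iff integrable_distr_eq integral_distr)
qed

lemma has_bochner_integral_pair_snd:
  assumes M: "prob_space M" and N: "sigma_finite_measure N" and f: "has_bochner_integral N (f :: 'a \<Rightarrow> real) c"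
  shows "has_bochner_integral (M \<Otimes>\<^sub>M N) (\<lambda>w. f (snd w)) c"
proof -
  interpret M: prob_space M by fact
  interpret N: sigma_finite_measure N by fact
  have "distr (M \<Otimes>\<^sub>M N) N snd = N"
  proof (rule measure_eqI)
    fix A assume "A \<in> sets (distr (M \<Otimes>\<^sub>M N) N snd)"
    then have A: "A \<in> sets N" by simp
    then have "emeasure (distr (M \<Otimes>\<^sub>M N) N snd) A = emeasure (M \<Otimes>\<^sub>M N) (space M \<times> A)"
      by (subst emeasure_distr) (auto simp: space_pair_measure dest: sets.sets_into_space intro!: arg_cong2[where f=emeasure])
    then show "emeasure (distr (M \<Otimes>\<^sub>M N) N snd) A = emeasure N A"
      using A by (simp add: N.emeasure_pair_measure_Times M.emeasure_space_1)
  qed simp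
  then have "has_bochner_integral (distr (M \<Otimes>\<^sub>M N) N snd) f c"
    using f by simp
  then show ?thesis
    using f by (simp add: has_bochner_integral_iff integrable_distr_eq integral_distr)
qed

lemma has_bochner_integral_noise_even_power:
  assumes "\<sigma> > 0"
  shows "has_bochner_integral (noise \<sigma>) (\<lambda>e. e ^ (2 * k)) (fact (2 * k) / (2 ^ k * fact k) * \<sigma> ^ (2 * k))"
  using normal_moment_even[OF assms, of 0 k] assms unfolding noise_def
  by (subst has_bochner_integral_density) (simp_all add: power_divide power_mult)

lemma has_bochner_integral_noise_mean:
  assumes "\<sigma> > 0"
  shows "has_bochner_integral (noise \<sigma>) (\<lambda>e. e) 0"
  using normal_moment_odd[OF assms, of 0 0] assms unfolding noise_def
  by (subst has_bochner_integral_density) simp_all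

definition resid :: "nat \<Rightarrow> (nat \<Rightarrow> real) \<Rightarrow> real \<times> (nat \<Rightarrow> real) \<Rightarrow> real" where
  "resid p b z = fst z - lin_fun p (snd z) b"

lemma measurable_lin_fun_snd: "(\<lambda>z. lin_fun p (snd z) v) \<in> borel_measurable (row_space p)"
  by (rule measurable_compose[OF measurable_snd measurable_lin_fun])

lemma measurable_resid: "resid p b \<in> borel_measurable (row_space p)"
  unfolding resid_def by (intro borel_measurable_diff measurable_fst measurable_lin_fun_snd)

lemma lin_fun_diff: "lin_fun p x v - lin_fun p x w = lin_fun p x (\<lambda>j. v j - w j)"
  by (simp add: lin_fun_def sum_subtractf[symmetric] algebra_simps)

lemma lin_fun_add: "lin_fun p x v + lin_fun p x w = lin_fun p x (\<lambda>j. v j + w j)"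
  by (simp add: lin_fun_def sum.distrib[symmetric] algebra_simps)

lemma resid_row: "resid p b (lin_fun p x \<beta> + e, x) = lin_fun p x (\<lambda>j. \<beta> j - b j) + e"
  by (simp add: resid_def lin_fun_diff[symmetric])

lemma has_bochner_integral_row_law:
  fixes f :: "real \<times> (nat \<Rightarrow> real) \<Rightarrow> real"
  assumes f: "f \<in> borel_measurable (row_space p)"
    and int: "has_bochner_integral (std_normal_vec p \<Otimes>\<^sub>M noise \<sigma>) (\<lambda>w. f (lin_fun p (fst w) \<beta> + snd w, fst w)) c"
  shows "has_bochner_integral (row_law p \<beta> \<sigma>) f c"
proof -
  have h: "(\<lambda>(x, e). (lin_fun p x \<beta> + e, x)) \<in> std_normal_vec p \<Otimes>\<^sub>M noise \<sigma> \<rightarrow>\<^sub>M row_space p"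
    by measurable
  show ?thesis
    using int integrable_distr_eq[OF h f] integral_distr[OF h f]
    by (simp add: has_bochner_integral_iff row_law_def split_def)
qed

lemma has_bochner_integral_lin_fun_pair:
  assumes "\<sigma> > 0"
  shows "has_bochner_integral (std_normal_vec p \<Otimes>\<^sub>M noise \<sigma>) (\<lambda>w. lin_fun p (fst w) v ^ (2 * k)) (fact (2 * k) / (2 ^ k * fact k) * sqnorm p v ^ k)"
  by (rule has_bochner_integral_pair_fst[OF prob_space_noise[OF assms] has_bochner_integral_lin_fun_even_power])

lemma has_bochner_integral_noise_pair:
  assumes "\<sigma> > 0"
  shows "has_bochner_integral (std_normal_vec p \<Otimes>\<^sub>M noise \<sigma>) (\<lambda>w. snd w ^ (2 * k)) (fact (2 * k) / (2 ^ k * fact k) * \<sigma> ^ (2 * k))"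
  by (rule has_bochner_integral_pair_snd[OF prob_space_std_normal_vec prob_space_imp_sigma_finite[OF prob_space_noise[OF assms]]
    has_bochner_integral_noise_even_power[OF assms]])

lemma has_bochner_integral_resid_true_square:
  assumes "\<sigma> > 0"
  shows "has_bochner_integral (row_law p \<beta> \<sigma>) (\<lambda>z. (resid p \<beta> z)\<^sup>2) (\<sigma>\<^sup>2)"
proof (rule has_bochner_integral_row_law)
  show "(\<lambda>z. (resid p \<beta> z)\<^sup>2) \<in> borel_measurable (row_space p)"
    by (intro borel_measurable_power measurable_resid)
  show "has_bochner_integral (std_normal_vec p \<Otimes>\<^sub>M noise \<sigma>)
     (\<lambda>w. (resid p \<beta> (lin_fun p (fst w) \<beta> + snd w, fst w))\<^sup>2) (\<sigma>\<^sup>2)"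
    using has_bochner_integral_noise_pair[OF assms, of p 1] by (simp add: resid_def fact_numeral)
qed

lemma has_bochner_integral_design_square:
  assumes "\<sigma> > 0"
  shows "has_bochner_integral (row_law p \<beta> \<sigma>) (\<lambda>z. sqnorm p (snd z)) (real p)"
proof (rule has_bochner_integral_row_law)
  have coord: "(\<lambda>z. snd z j) \<in> borel_measurable (row_space p)" if "j \<in> {..<p}" for j
    by (rule measurable_compose[OF measurable_snd measurable_component_singleton[OF that]])
  show "(\<lambda>z. sqnorm p (snd z)) \<in> borel_measurable (row_space p)"
    unfolding sqnorm_def by (intro borel_measurable_sum borel_measurable_power coord)
  have "has_bochner_integral (std_normal_vec p \<Otimes>\<^sub>M noise \<sigma>) (\<lambda>w. (fst w j)\<^sup>2) 1" if "j \<in> {..<p}" for j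
  proof -
    define u :: "nat \<Rightarrow> real" where "u = (\<lambda>i. if i = j then 1 else 0)"
    have "lin_fun p x u = x j" for x
      using that unfolding lin_fun_def u_def by (simp add: if_distrib[of "(*) _"] cong: if_cong)
    moreover have "sqnorm p u = 1"
      using that unfolding sqnorm_def u_def by (simp add: if_distrib[of "\<lambda>t. t\<^sup>2"] cong: if_cong)
    ultimately show ?thesis
      using has_bochner_integral_lin_fun_pair[OF assms, of p u 1] by (simp add: fact_numeral)
  qed
  then have "has_bochner_integral (std_normal_vec p \<Otimes>\<^sub>M noise \<sigma>) (\<lambda>w. \<Sum>j<p. (fst w j)\<^sup>2) (\<Sum>j<p. 1)"
    by (rule has_bochner_integral_sum)
  then show "has_bochner_integral (std_normal_vec p \<Otimes>\<^sub>M noise \<sigma>) (\<lambda>w. sqnorm p (snd (lin_fun p (fst w) \<beta> + snd w, fst w))) (real p)"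
    by (simp add: sqnorm_def)
qed

lemma has_bochner_integral_lin_fun_times_noise:
  assumes \<sigma>: "\<sigma> > 0"
  shows "has_bochner_integral (std_normal_vec p \<Otimes>\<^sub>M noise \<sigma>) (\<lambda>w. lin_fun p (fst w) v * snd w) 0"
proof -
  interpret N: prob_space "std_normal_vec p" by (rule prob_space_std_normal_vec)
  interpret E: prob_space "noise \<sigma>" by (rule prob_space_noise[OF \<sigma>])
  interpret pair_sigma_finite "std_normal_vec p" "noise \<sigma>" ..
  have "integrable (std_normal_vec p \<Otimes>\<^sub>M noise \<sigma>) (\<lambda>w. (lin_fun p (fst w) v)\<^sup>2 + (snd w)\<^sup>2)"
    using has_bochner_integral_lin_fun_pair[OF \<sigma>, of p v 1] has_bochner_integral_noise_pair[OF \<sigma>, of p 1]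
    by (simp add: has_bochner_integral_iff)
  then have int: "integrable (std_normal_vec p \<Otimes>\<^sub>M noise \<sigma>) (\<lambda>w. lin_fun p (fst w) v * snd w)"
  proof (rule Bochner_Integration.integrable_bound)
    show "(\<lambda>w. lin_fun p (fst w) v * snd w) \<in> borel_measurable (std_normal_vec p \<Otimes>\<^sub>M noise \<sigma>)"
      by measurable
    have "\<bar>a * b\<bar> \<le> \<bar>a\<^sup>2 + b\<^sup>2\<bar>" for a b :: real
    proof -
      have "0 \<le> (\<bar>a\<bar> - \<bar>b\<bar>)\<^sup>2" by simp
      then have "2 * (\<bar>a\<bar> * \<bar>b\<bar>) \<le> a\<^sup>2 + b\<^sup>2" by (simp add: power2_diff)
      moreover have "0 \<le> \<bar>a\<bar> * \<bar>b\<bar>" by simp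
      ultimately show ?thesis unfolding abs_mult by linarith
    qed
    then show "AE w in std_normal_vec p \<Otimes>\<^sub>M noise \<sigma>. norm (lin_fun p (fst w) v * snd w) \<le> norm ((lin_fun p (fst w) v)\<^sup>2 + (snd w)\<^sup>2)"
      by simp
  qed
  have "(\<integral>w. lin_fun p (fst w) v * snd w \<partial>(std_normal_vec p \<Otimes>\<^sub>M noise \<sigma>)) = (\<integral>x. \<integral>e. lin_fun p x v * e \<partial>noise \<sigma> \<partial>std_normal_vec p)"
    using integral_fst'[OF int] by simp
  also have "\<dots> = 0"
    using has_bochner_integral_noise_mean[OF \<sigma>] by (simp add: has_bochner_integral_iff)
  finally show ?thesis
    using int by (simp add: has_bochner_integral_iff)
qed

text \<open>Here the identity covariance enters: (x . \<xi>) (x . d) has expectation \<xi> . d, by polarisation from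
the second moments of linear forms, and the noise contributes nothing. So the product
is an unbiased estimator of the error \<xi> . (\<beta> - b) of the plug-in value \<xi> . b.\<close>

lemma has_bochner_integral_score:
  assumes \<sigma>: "\<sigma> > 0"
  shows "has_bochner_integral (row_law p \<beta> \<sigma>) (\<lambda>z. lin_fun p (snd z) \<xi> * resid p b z)
    (lin_fun p \<xi> \<beta> - lin_fun p \<xi> b)"
proof (rule has_bochner_integral_row_law)
  show "(\<lambda>z. lin_fun p (snd z) \<xi> * resid p b z) \<in> borel_measurable (row_space p)"
    by (intro borel_measurable_times measurable_resid measurable_lin_fun_snd)
  define d where "d = (\<lambda>j. \<beta> j - b j)"
  let ?P = "std_normal_vec p \<Otimes>\<^sub>M noise \<sigma>"
  have "has_bochner_integral ?P (\<lambda>w. (lin_fun p (fst w) (\<lambda>j. \<xi> j + d j))\<^sup>2) (sqnorm p (\<lambda>j. \<xi> j + d j))"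
    "has_bochner_integral ?P (\<lambda>w. (lin_fun p (fst w) (\<lambda>j. \<xi> j - d j))\<^sup>2) (sqnorm p (\<lambda>j. \<xi> j - d j))"
    using has_bochner_integral_lin_fun_pair[OF \<sigma>, of p _ 1] by (simp_all add: fact_numeral)
  from has_bochner_integral_divide_zero[OF has_bochner_integral_diff[OF this], of 4]
  have "has_bochner_integral ?P (\<lambda>w. ((lin_fun p (fst w) (\<lambda>j. \<xi> j + d j))\<^sup>2 - (lin_fun p (fst w) (\<lambda>j. \<xi> j - d j))\<^sup>2) / 4)
    ((sqnorm p (\<lambda>j. \<xi> j + d j) - sqnorm p (\<lambda>j. \<xi> j - d j)) / 4)" .
  moreover have "((lin_fun p x (\<lambda>j. \<xi> j + d j))\<^sup>2 - (lin_fun p x (\<lambda>j. \<xi> j - d j))\<^sup>2) / 4 = lin_fun p x \<xi> * lin_fun p x d" for x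
    by (simp add: lin_fun_add[symmetric] lin_fun_diff[symmetric] power2_eq_square algebra_simps)
  moreover have "(sqnorm p (\<lambda>j. \<xi> j + d j) - sqnorm p (\<lambda>j. \<xi> j - d j)) / 4 = lin_fun p \<xi> d"
    unfolding sqnorm_def lin_fun_def sum_subtractf[symmetric] sum_divide_distrib
    by (intro sum.cong) (auto simp: power2_eq_square algebra_simps)
  ultimately have "has_bochner_integral ?P (\<lambda>w. lin_fun p (fst w) \<xi> * lin_fun p (fst w) d) (lin_fun p \<xi> d)"
    by simp
  from has_bochner_integral_add[OF this has_bochner_integral_lin_fun_times_noise[OF \<sigma>, of p \<xi>]]
  show "has_bochner_integral ?P (\<lambda>w. lin_fun p (snd (lin_fun p (fst w) \<beta> + snd w, fst w)) \<xi> * resid p b (lin_fun p (fst w) \<beta> + snd w, fst w))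
     (lin_fun p \<xi> \<beta> - lin_fun p \<xi> b)"
    by (simp add: resid_row d_def lin_fun_diff distrib_left)
qed

text \<open>With s = |\<xi>|^2, the weighted inequality 2 (a w)^2 \<le> a^4 / s + s w^4 reduces the claim to fourth
moments; the weights are such that both terms are of order s.\<close>

lemma score_second_moment:
  assumes \<sigma>: "\<sigma> > 0" and s: "sqnorm p \<xi> > 0" and D: "sqnorm p (\<lambda>j. \<beta> j - b j) \<le> D"
  shows "integrable (row_law p \<beta> \<sigma>) (\<lambda>z. (lin_fun p (snd z) \<xi> * resid p b z)\<^sup>2)" (is ?I)
    and "(\<integral>z. (lin_fun p (snd z) \<xi> * resid p b z)\<^sup>2 \<partial>row_law p \<beta> \<sigma>) \<le> sqnorm p \<xi> * (2 + 12 * (D\<^sup>2 + \<sigma> ^ 4))" (is ?E)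
proof -
  define d where "d = (\<lambda>j. \<beta> j - b j)"
  let ?P = "std_normal_vec p \<Otimes>\<^sub>M noise \<sigma>" and ?R = "row_law p \<beta> \<sigma>" and ?s = "sqnorm p \<xi>"
  let ?f = "\<lambda>z. (lin_fun p (snd z) \<xi> * resid p b z)\<^sup>2"
  let ?h = "\<lambda>w. 1 / (2 * ?s) * lin_fun p (fst w) \<xi> ^ 4 + 4 * ?s * (lin_fun p (fst w) d ^ 4 + snd w ^ 4)"
  let ?c = "1 / (2 * ?s) * (3 * ?s\<^sup>2) + 4 * ?s * (3 * (sqnorm p d)\<^sup>2 + 3 * \<sigma> ^ 4)"
  have fm: "?f \<in> borel_measurable (row_space p)"
    by (intro borel_measurable_power borel_measurable_times measurable_resid measurable_lin_fun_snd)
  have h: "has_bochner_integral ?P ?h ?c"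
    using has_bochner_integral_lin_fun_pair[OF \<sigma>, of p \<xi> 2] has_bochner_integral_lin_fun_pair[OF \<sigma>, of p d 2]
      has_bochner_integral_noise_pair[OF \<sigma>, of p 2]
    by (intro has_bochner_integral_add has_bochner_integral_mult_right) (simp_all add: fact_numeral)
  have bound: "(a * (t + e))\<^sup>2 \<le> 1 / (2 * ?s) * a ^ 4 + 4 * ?s * (t ^ 4 + e ^ 4)" for a t e :: real
  proof -
    have quartic: "(t + e) ^ 4 \<le> 8 * (t ^ 4 + e ^ 4)"
    proof -
      have "(t + e)\<^sup>2 \<le> 2 * (t\<^sup>2 + e\<^sup>2)"
        using zero_le_power2[of "t - e"] by (simp add: power2_eq_square algebra_simps)
      then have "((t + e)\<^sup>2)\<^sup>2 \<le> (2 * (t\<^sup>2 + e\<^sup>2))\<^sup>2" by (rule power_mono) simp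
      also have "\<dots> \<le> 8 * (t ^ 4 + e ^ 4)"
        using zero_le_power2[of "t\<^sup>2 - e\<^sup>2"] by (simp add: power2_eq_square power4_eq_xxxx algebra_simps)
      finally show ?thesis by (simp add: power_mult[symmetric])
    qed
    have "2 * (a * (t + e))\<^sup>2 \<le> a ^ 4 / ?s + ?s * (t + e) ^ 4"
    proof -
      have "0 \<le> (a\<^sup>2 - ?s * (t + e)\<^sup>2)\<^sup>2 / ?s" using s by simp
      also have "\<dots> = a ^ 4 / ?s + ?s * (t + e) ^ 4 - 2 * (a * (t + e))\<^sup>2"
        using s by (simp add: power2_diff power_mult_distrib power_mult[symmetric] diff_divide_distrib add_divide_distrib power2_eq_square[of ?s])
      finally show ?thesis by simp
    qed
    also have "\<dots> \<le> a ^ 4 / ?s + ?s * (8 * (t ^ 4 + e ^ 4))"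
      using quartic s by (intro add_left_mono mult_left_mono) auto
    finally show ?thesis by (simp add: field_simps)
  qed
  have le: "?f (lin_fun p (fst w) \<beta> + snd w, fst w) \<le> ?h w" for w
    using bound[of "lin_fun p (fst w) \<xi>" "lin_fun p (fst w) d" "snd w"] by (simp add: resid_row d_def)
  have m: "(\<lambda>w. ?f (lin_fun p (fst w) \<beta> + snd w, fst w)) \<in> borel_measurable ?P"
  proof -
    have "(\<lambda>w. (lin_fun p (fst w) \<beta> + snd w, fst w)) \<in> ?P \<rightarrow>\<^sub>M row_space p"
      by measurable
    from measurable_compose[OF this fm] show ?thesis .
  qed
  have int: "integrable ?P (\<lambda>w. ?f (lin_fun p (fst w) \<beta> + snd w, fst w))"
  proof (rule Bochner_Integration.integrable_bound[OF _ m])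
    show "integrable ?P ?h" using h by (simp only: has_bochner_integral_iff)
    show "AE w in ?P. norm (?f (lin_fun p (fst w) \<beta> + snd w, fst w)) \<le> norm (?h w)"
    proof (rule AE_I2)
      fix w
      have "norm (?f (lin_fun p (fst w) \<beta> + snd w, fst w)) = ?f (lin_fun p (fst w) \<beta> + snd w, fst w)" by simp
      also note le[of w]
      also have "?h w \<le> norm (?h w)" by (simp only: real_norm_def abs_ge_self)
      finally show "norm (?f (lin_fun p (fst w) \<beta> + snd w, fst w)) \<le> norm (?h w)" .
    qed
  qed
  have hb: "has_bochner_integral ?R ?f (\<integral>w. ?f (lin_fun p (fst w) \<beta> + snd w, fst w) \<partial>?P)"
    by (rule has_bochner_integral_row_law[OF fm has_bochner_integral_integrable[OF int]])
  then show ?I by (simp only: has_bochner_integral_iff)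
  have "(\<integral>z. ?f z \<partial>?R) = (\<integral>w. ?f (lin_fun p (fst w) \<beta> + snd w, fst w) \<partial>?P)"
    using hb by (simp only: has_bochner_integral_iff)
  also have "\<dots> \<le> (\<integral>w. ?h w \<partial>?P)"
    using h by (intro integral_mono int le) (simp only: has_bochner_integral_iff)
  also have "\<dots> = ?c" using h by (simp only: has_bochner_integral_iff)
  also have "\<dots> \<le> ?s * (2 + 12 * (D\<^sup>2 + \<sigma> ^ 4))"
  proof -
    have "(sqnorm p d)\<^sup>2 \<le> D\<^sup>2" using D by (intro power_mono) (auto simp: d_def)
    then have "4 * ?s * (3 * (sqnorm p d)\<^sup>2 + 3 * \<sigma> ^ 4) \<le> 4 * ?s * (3 * D\<^sup>2 + 3 * \<sigma> ^ 4)"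
      using s by (intro mult_left_mono) auto
    moreover have "1 / (2 * ?s) * (3 * ?s\<^sup>2) \<le> 2 * ?s" using s by (simp add: power2_eq_square)
    ultimately show ?thesis by (simp add: algebra_simps)
  qed
  finally show ?E .
qed

section \<open>Sparse vectors are not nearly annihilated by the design\<close>

text \<open>The value is 1 / l for the exponential tilt l with 1 + l / 2 = exp 4, which makes the
factor contributed by one observation to the Chernoff bound at most exp (-2).\<close>

definition small_ball_const :: real where
  "small_ball_const = 1 / (2 * (exp 4 - 1))"

lemma small_ball_const_pos: "small_ball_const > 0"
  by (simp add: small_ball_const_def)

lemma measurable_design_square:
  "(\<lambda>z. \<Sum>i\<in>I. (lin_fun p (snd (z i)) v)\<^sup>2) \<in> borel_measurable (Pi\<^sub>M I (\<lambda>_. row_law p \<beta> \<sigma>))"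
proof (intro borel_measurable_sum borel_measurable_power)
  fix i assume "i \<in> I"
  have "(\<lambda>z. lin_fun p (snd z) v) \<in> borel_measurable (row_law p \<beta> \<sigma>)"
    by (subst measurable_cong_sets[OF sets_row_law refl]) (rule measurable_lin_fun_snd)
  then show "(\<lambda>z. lin_fun p (snd (z i)) v) \<in> borel_measurable (Pi\<^sub>M I (\<lambda>_. row_law p \<beta> \<sigma>))"
    by (rule measurable_compose[OF measurable_component_singleton[OF \<open>i \<in> I\<close>]])
qed

lemma nn_integral_row_law_exp_square:
  assumes \<sigma>: "\<sigma> > 0" and s: "2 * s * sqnorm p v < 1"
  shows "(\<integral>\<^sup>+z. ennreal (exp (s * (lin_fun p (snd z) v)\<^sup>2)) \<partial>row_law p \<beta> \<sigma>) = ennreal (1 / sqrt (1 - 2 * s * sqnorm p v))"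
proof -
  interpret E: prob_space "noise \<sigma>" by (rule prob_space_noise[OF \<sigma>])
  have h: "(\<lambda>(x, e). (lin_fun p x \<beta> + e, x)) \<in> std_normal_vec p \<Otimes>\<^sub>M noise \<sigma> \<rightarrow>\<^sub>M row_space p"
    by measurable
  have "(\<lambda>z. (lin_fun p (snd z) v)\<^sup>2) \<in> borel_measurable (row_space p)"
    by (intro borel_measurable_power measurable_lin_fun_snd)
  then have f: "(\<lambda>z. ennreal (exp (s * (lin_fun p (snd z) v)\<^sup>2))) \<in> borel_measurable (row_space p)"
    by simp
  have g: "(\<lambda>x. ennreal (exp (s * (lin_fun p x v)\<^sup>2))) \<in> borel_measurable (std_normal_vec p)"
    by measurable
  have "(\<integral>\<^sup>+z. ennreal (exp (s * (lin_fun p (snd z) v)\<^sup>2)) \<partial>row_law p \<beta> \<sigma>)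
      = (\<integral>\<^sup>+w. ennreal (exp (s * (lin_fun p (fst w) v)\<^sup>2)) \<partial>(std_normal_vec p \<Otimes>\<^sub>M noise \<sigma>))"
    unfolding row_law_def by (subst nn_integral_distr[OF h]) (simp_all add: f split_def)
  also have "\<dots> = (\<integral>\<^sup>+x. \<integral>\<^sup>+e. ennreal (exp (s * (lin_fun p (fst (x, e)) v)\<^sup>2)) \<partial>noise \<sigma> \<partial>std_normal_vec p)"
    by (rule E.nn_integral_fst[symmetric]) (rule measurable_compose[OF measurable_fst g])
  also have "\<dots> = (\<integral>\<^sup>+x. ennreal (exp (s * (lin_fun p x v)\<^sup>2)) \<partial>std_normal_vec p)"
    using E.emeasure_space_1 by (simp del: space_noise)
  also have "\<dots> = ennreal (1 / sqrt (1 - 2 * s * sqnorm p v))"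
    by (rule nn_integral_exp_square_lin_fun[OF s])
  finally show ?thesis .
qed

text \<open>Chernoff bound for the lower tail: at a = |I| / l, the factor exp (l a) costs exp 1 for each
observation, whereas the Laplace transform at l gains exp (-2).\<close>

lemma small_ball_fixed_direction:
  assumes \<sigma>: "\<sigma> > 0" and I: "finite I" and v: "sqnorm p v \<ge> 1 / 4"
  shows "measure (Pi\<^sub>M I (\<lambda>_. row_law p \<beta> \<sigma>))
     {z \<in> space (Pi\<^sub>M I (\<lambda>_. row_law p \<beta> \<sigma>)). (\<Sum>i\<in>I. (lin_fun p (snd (z i)) v)\<^sup>2) \<le> small_ball_const * real (card I)}
     \<le> exp (- real (card I))"
proof -
  let ?R = "row_law p \<beta> \<sigma>" and ?P = "Pi\<^sub>M I (\<lambda>_. row_law p \<beta> \<sigma>)"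
  interpret R: prob_space ?R by (rule prob_space_row_law[OF \<sigma>])
  interpret product_sigma_finite "\<lambda>_. ?R" ..
  interpret prob_space ?P by (intro prob_space_PiM R.prob_space_axioms)
  define l :: real where "l = 2 * (exp 4 - 1)"
  have l: "l > 0" by (simp add: l_def)
  have c: "l * small_ball_const = 1" using l by (simp add: small_ball_const_def l_def)
  let ?Y = "\<lambda>z. \<Sum>i\<in>I. (lin_fun p (snd (z i)) v)\<^sup>2"
  let ?a = "small_ball_const * real (card I)"
  have Y: "?Y \<in> borel_measurable ?P" by (rule measurable_design_square)
  have one: "(\<integral>\<^sup>+z. ennreal (exp (- l * (lin_fun p (snd z) v)\<^sup>2)) \<partial>?R) \<le> ennreal (exp (- 2))"
  proof -
    have "2 * (- l) * sqnorm p v < 1" using l by (simp add: mult_nonneg_nonneg less_le_trans[of _ 0])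
    then have "(\<integral>\<^sup>+z. ennreal (exp (- l * (lin_fun p (snd z) v)\<^sup>2)) \<partial>?R) = ennreal (1 / sqrt (1 - 2 * (- l) * sqnorm p v))"
      by (rule nn_integral_row_law_exp_square[OF \<sigma>])
    also have "1 / sqrt (1 - 2 * (- l) * sqnorm p v) \<le> 1 / sqrt (exp 4)"
    proof -
      have "exp 4 = 1 + 2 * l * (1 / 4)" by (simp add: l_def field_simps)
      also have "\<dots> \<le> 1 - 2 * (- l) * sqnorm p v" using v l by simp
      finally show ?thesis by (intro frac_le real_sqrt_le_mono) simp_all
    qed
    also have "1 / sqrt (exp 4) = exp (- 2 :: real)"
    proof -
      have "sqrt (exp 4) = (exp 2 :: real)" by (rule real_sqrt_unique) (simp_all add: exp_double[symmetric])
      then show ?thesis by (simp add: exp_minus field_simps)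
    qed
    finally show ?thesis by (simp add: ennreal_leI)
  qed
  have "emeasure ?P {z \<in> space ?P. ?Y z \<le> ?a} \<le> ennreal (exp (l * ?a)) * (\<integral>\<^sup>+z. ennreal (exp (- l * ?Y z)) * indicator (space ?P) z \<partial>?P)"
    by (rule Chernoff_ineq_nn_integral_le[OF l sets.top Y])
  also have "(\<integral>\<^sup>+z. ennreal (exp (- l * ?Y z)) * indicator (space ?P) z \<partial>?P) = (\<integral>\<^sup>+z. (\<Prod>i\<in>I. ennreal (exp (- l * (lin_fun p (snd (z i)) v)\<^sup>2))) \<partial>?P)"
    using I by (intro nn_integral_cong) (simp add: prod_ennreal exp_sum sum_distrib_left sum_negf[symmetric])
  also have "\<dots> = (\<Prod>i\<in>I. \<integral>\<^sup>+z. ennreal (exp (- l * (lin_fun p (snd z) v)\<^sup>2)) \<partial>?R)"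
  proof (rule product_nn_integral_prod[OF I])
    have "(\<lambda>z. (lin_fun p (snd z) v)\<^sup>2) \<in> borel_measurable ?R"
      by (subst measurable_cong_sets[OF sets_row_law refl]) (intro borel_measurable_power measurable_lin_fun_snd)
    then show "(\<lambda>z. ennreal (exp (- l * (lin_fun p (snd z) v)\<^sup>2))) \<in> borel_measurable ?R" by simp
  qed
  also have "\<dots> \<le> (\<Prod>i\<in>I. ennreal (exp (- 2)))"
    by (intro prod_mono_ennreal one)
  also have "\<dots> = ennreal (exp (- 2 * real (card I)))"
    by (simp add: ennreal_power exp_of_nat_mult[symmetric] mult.commute)
  also have "ennreal (exp (l * ?a)) * ennreal (exp (- 2 * real (card I))) = ennreal (exp (- real (card I)))"
  proof -
    have "l * ?a = real (card I)" using c by (simp add: mult.assoc[symmetric])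
    then show ?thesis by (simp add: ennreal_mult'[symmetric] exp_add[symmetric])
  qed
  finally show ?thesis
    by (simp add: emeasure_eq_measure mult_left_mono)
qed

text \<open>A net for m-sparse vectors with entries in [-1, 1]: a choice of m pairs (coordinate, multiple of
1 / p^2). Coordinates may repeat, so no support has to be fixed first and the
number of choices is a plain power.\<close>

definition grid_index :: "nat \<Rightarrow> nat \<Rightarrow> (nat \<Rightarrow> nat \<times> int) set" where
  "grid_index p m = {..<m} \<rightarrow>\<^sub>E {..<p} \<times> {- int (p\<^sup>2)..int (p\<^sup>2)}"

definition grid_vec :: "nat \<Rightarrow> nat \<Rightarrow> (nat \<Rightarrow> nat \<times> int) \<Rightarrow> nat \<Rightarrow> real" where
  "grid_vec p m f j = (\<Sum>l<m. if fst (f l) = j then of_int (snd (f l)) / (real p)\<^sup>2 else 0)"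

lemma finite_grid_index: "finite (grid_index p m)"
  unfolding grid_index_def by (intro finite_PiE) auto

lemma card_grid_index:
  assumes "p \<ge> 3"
  shows "card (grid_index p m) \<le> p ^ (4 * m)"
proof -
  have "card {- int (p\<^sup>2)..int (p\<^sup>2)} = nat (int (2 * p\<^sup>2 + 1))" by (simp add: algebra_simps)
  then have "card {- int (p\<^sup>2)..int (p\<^sup>2)} = 2 * p\<^sup>2 + 1" by (simp only: nat_int)
  then have "card (grid_index p m) = (p * (2 * p\<^sup>2 + 1)) ^ m"
    unfolding grid_index_def by (simp only: card_PiE finite_lessThan prod_constant card_lessThan card_cartesian_product)
  also have "\<dots> \<le> (p * p ^ 3) ^ m"
  proof (intro power_mono mult_left_mono)
    have "2 * p\<^sup>2 + 1 \<le> 3 * p\<^sup>2" using assms by simp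
    also have "\<dots> \<le> p * p\<^sup>2" using assms by (rule mult_right_mono) simp
    finally show "2 * p\<^sup>2 + 1 \<le> p ^ 3" by (simp add: power2_eq_square power3_eq_cube)
  qed auto
  also have "(p * p ^ 3) ^ m = p ^ (4 * m)"
    by (simp add: power_mult power_Suc[symmetric] del: power_Suc)
  finally show ?thesis .
qed

text \<open>The pairs list the support of u, each entry being rounded down; the remaining pairs are (0, 0) and
add nothing.\<close>

lemma grid_approximation:
  assumes p: "p > 0" and supp: "card (vec_supp p u) \<le> m" and u: "\<And>j. j < p \<Longrightarrow> \<bar>u j\<bar> \<le> 1"
  obtains f where "f \<in> grid_index p m" "\<And>j. j < p \<Longrightarrow> \<bar>u j - grid_vec p m f j\<bar> \<le> 1 / (real p)\<^sup>2"
proof -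
  let ?S = "vec_supp p u"
  have fin: "finite ?S" by (simp add: vec_supp_def)
  obtain g where g: "bij_betw g {..<card ?S} ?S"
    using ex_bij_betw_nat_finite[OF fin] by (auto simp: atLeast0LessThan)
  define f where "f = (\<lambda>l\<in>{..<m}. if l < card ?S then (g l, \<lfloor>(real p)\<^sup>2 * u (g l)\<rfloor>) else (0, 0))"
  have gS: "g l < p" if "l < card ?S" for l
    using bij_betwE[OF g] that by (auto simp: vec_supp_def)
  have fl: "\<lfloor>(real p)\<^sup>2 * t\<rfloor> \<in> {- int (p\<^sup>2)..int (p\<^sup>2)}" if "\<bar>t\<bar> \<le> 1" for t :: real
  proof -
    have "\<bar>(real p)\<^sup>2 * t\<bar> \<le> (real p)\<^sup>2" using that by (simp add: abs_mult mult_left_le)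
    then have "- ((real p)\<^sup>2) \<le> (real p)\<^sup>2 * t" "(real p)\<^sup>2 * t \<le> (real p)\<^sup>2" by linarith+
    then show ?thesis by (simp add: le_floor_iff floor_le_iff)
  qed
  have "f \<in> grid_index p m"
    unfolding grid_index_def f_def using gS u p fl by (auto split: if_splits)
  moreover have "\<bar>u j - grid_vec p m f j\<bar> \<le> 1 / (real p)\<^sup>2" if j: "j < p" for j
  proof -
    have *: "grid_vec p m f j = (\<Sum>l<card ?S. if g l = j then of_int \<lfloor>(real p)\<^sup>2 * u j\<rfloor> / (real p)\<^sup>2 else 0)"
      unfolding grid_vec_def using supp
      by (intro sum.mono_neutral_cong_right) (auto simp: f_def split: if_splits)
    also have "\<dots> = (\<Sum>i\<in>?S. if i = j then of_int \<lfloor>(real p)\<^sup>2 * u j\<rfloor> / (real p)\<^sup>2 else 0)"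
      by (rule sum.reindex_bij_betw[OF g, of "\<lambda>i. if i = j then of_int \<lfloor>(real p)\<^sup>2 * u j\<rfloor> / (real p)\<^sup>2 else 0"])
    also have "\<dots> = (if j \<in> ?S then of_int \<lfloor>(real p)\<^sup>2 * u j\<rfloor> / (real p)\<^sup>2 else 0)"
      using fin by simp
    also have "\<dots> = of_int \<lfloor>(real p)\<^sup>2 * u j\<rfloor> / (real p)\<^sup>2"
      using j by (auto simp: vec_supp_def)
    finally have "u j - grid_vec p m f j = ((real p)\<^sup>2 * u j - of_int \<lfloor>(real p)\<^sup>2 * u j\<rfloor>) / (real p)\<^sup>2"
      using p by (simp add: diff_divide_distrib)
    moreover have "\<bar>(real p)\<^sup>2 * u j - of_int \<lfloor>(real p)\<^sup>2 * u j\<rfloor>\<bar> \<le> 1" by linarith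
    ultimately show ?thesis by (simp add: abs_divide divide_right_mono)
  qed
  ultimately show ?thesis using that by blast
qed

lemma lin_fun_square_le: "(lin_fun p x v)\<^sup>2 \<le> sqnorm p x * sqnorm p v"
  unfolding lin_fun_def sqnorm_def by (rule Cauchy_Schwarz_ineq_sum)

lemma lin_fun_scale: "lin_fun p x (\<lambda>j. c * v j) = c * lin_fun p x v"
  by (simp add: lin_fun_def sum_distrib_left ac_simps)

lemma sqnorm_scale: "sqnorm p (\<lambda>j. c * v j) = c\<^sup>2 * sqnorm p v"
  by (simp add: sqnorm_def sum_distrib_left power_mult_distrib)

lemma square_sum_le: "(a + b)\<^sup>2 \<le> 2 * a\<^sup>2 + 2 * (b::real)\<^sup>2"
  using zero_le_power2[of "a - b"] by (simp add: power2_eq_square algebra_simps)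

text \<open>A uniform bound from one on the grid. After scaling v to unit length, the rounding error w
satisfies |w|^2 \<le> p / p^4. Because the mesh is this fine, Cauchy-Schwarz with the
Frobenius norm of the design, of squared size O(card I * p), already makes the contribution
of w negligible.\<close>

lemma restricted_lower_isometry:
  fixes z :: "'i \<Rightarrow> real \<times> (nat \<Rightarrow> real)"
  assumes p: "p \<ge> 2" "4 * K \<le> small_ball_const * (real p)\<^sup>2" and I: "finite I"
    and frob: "(\<Sum>i\<in>I. sqnorm p (snd (z i))) \<le> K * real (card I) * real p"
    and grid: "\<And>f. f \<in> grid_index p m \<Longrightarrow> sqnorm p (grid_vec p m f) \<ge> 1 / 4 \<Longrightarrow>
        small_ball_const * real (card I) \<le> (\<Sum>i\<in>I. (lin_fun p (snd (z i)) (grid_vec p m f))\<^sup>2)"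
    and supp: "card (vec_supp p v) \<le> m"
  shows "small_ball_const / 4 * real (card I) * sqnorm p v \<le> (\<Sum>i\<in>I. (lin_fun p (snd (z i)) v)\<^sup>2)"
proof (cases "sqnorm p v = 0")
  case True
  then show ?thesis by (simp add: sum_nonneg)
next
  case False
  then have pos: "sqnorm p v > 0" using sqnorm_nonneg[of p v] by linarith
  let ?c = small_ball_const and ?h = "real (card I)"
  define r where "r = 1 / sqrt (sqnorm p v)"
  define u where "u = (\<lambda>j. r * v j)"
  have r: "r \<noteq> 0" "r\<^sup>2 = 1 / sqnorm p v" using pos by (simp_all add: r_def power_divide)
  have su: "sqnorm p u = 1" using pos r by (simp add: u_def sqnorm_scale)
  have "vec_supp p u = vec_supp p v" using r by (simp add: vec_supp_def u_def)
  moreover have "\<bar>u j\<bar> \<le> 1" if "j < p" for j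
  proof -
    have "(u j)\<^sup>2 \<le> sqnorm p u"
      unfolding sqnorm_def using that by (intro member_le_sum) auto
    then show ?thesis by (simp add: su abs_square_le_1)
  qed
  ultimately obtain f where f: "f \<in> grid_index p m" and close: "\<And>j. j < p \<Longrightarrow> \<bar>u j - grid_vec p m f j\<bar> \<le> 1 / (real p)\<^sup>2"
    using grid_approximation[of p u m] p supp by auto
  let ?g = "grid_vec p m f"
  define w where "w = (\<lambda>j. u j - ?g j)"
  have sw: "sqnorm p w \<le> 1 / (real p) ^ 3"
  proof -
    have "sqnorm p w \<le> (\<Sum>j<p. (1 / (real p)\<^sup>2)\<^sup>2)"
      unfolding sqnorm_def
    proof (rule sum_mono)
      fix j assume "j \<in> {..<p}"
      then have "\<bar>w j\<bar> \<le> 1 / (real p)\<^sup>2" using close by (simp add: w_def)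
      then have "\<bar>w j\<bar>\<^sup>2 \<le> (1 / (real p)\<^sup>2)\<^sup>2" by (rule power_mono) simp
      then show "(w j)\<^sup>2 \<le> (1 / (real p)\<^sup>2)\<^sup>2" by simp
    qed
    also have "\<dots> = 1 / (real p) ^ 3"
      using p by (simp add: power_divide power2_eq_square power3_eq_cube)
    finally show ?thesis .
  qed
  have "1 / (real p) ^ 3 \<le> 1 / 2 ^ 3"
    using p by (intro divide_left_mono power_mono) auto
  then have sw': "sqnorm p w \<le> 1 / 8" using sw by simp
  have "sqnorm p u \<le> (\<Sum>j<p. 2 * (?g j)\<^sup>2 + 2 * (w j)\<^sup>2)"
    unfolding sqnorm_def
  proof (rule sum_mono)
    fix j
    show "(u j)\<^sup>2 \<le> 2 * (?g j)\<^sup>2 + 2 * (w j)\<^sup>2"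
      using square_sum_le[of "?g j" "w j"] by (simp add: w_def)
  qed
  also have "\<dots> = 2 * sqnorm p ?g + 2 * sqnorm p w"
    by (simp add: sqnorm_def sum.distrib sum_distrib_left)
  finally have "sqnorm p ?g \<ge> 1 / 4" using su sw' by simp
  from grid[OF f this] have "?c * ?h \<le> (\<Sum>i\<in>I. (lin_fun p (snd (z i)) ?g)\<^sup>2)" .
  also have "\<dots> \<le> (\<Sum>i\<in>I. 2 * (lin_fun p (snd (z i)) u)\<^sup>2 + 2 * (sqnorm p (snd (z i)) * sqnorm p w))"
  proof (rule sum_mono)
    fix i
    have "lin_fun p (snd (z i)) ?g = lin_fun p (snd (z i)) u + - lin_fun p (snd (z i)) w"
      by (simp add: w_def lin_fun_diff[symmetric])
    then have "(lin_fun p (snd (z i)) ?g)\<^sup>2 \<le> 2 * (lin_fun p (snd (z i)) u)\<^sup>2 + 2 * (lin_fun p (snd (z i)) w)\<^sup>2"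
      using square_sum_le[of "lin_fun p (snd (z i)) u" "- lin_fun p (snd (z i)) w"] by simp
    then show "(lin_fun p (snd (z i)) ?g)\<^sup>2 \<le> 2 * (lin_fun p (snd (z i)) u)\<^sup>2 + 2 * (sqnorm p (snd (z i)) * sqnorm p w)"
      using lin_fun_square_le[of p "snd (z i)" w] by linarith
  qed
  also have "\<dots> = 2 * (\<Sum>i\<in>I. (lin_fun p (snd (z i)) u)\<^sup>2) + 2 * (sqnorm p w * (\<Sum>i\<in>I. sqnorm p (snd (z i))))"
    by (simp add: sum.distrib sum_distrib_left ac_simps)
  also have "sqnorm p w * (\<Sum>i\<in>I. sqnorm p (snd (z i))) \<le> 1 / (real p) ^ 3 * (K * ?h * real p)"
    using sw frob by (intro mult_mono) (auto intro: sum_nonneg)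
  also have "\<dots> = K / (real p)\<^sup>2 * ?h"
    using p by (simp add: power2_eq_square power3_eq_cube)
  also have "\<dots> \<le> ?c / 4 * ?h"
    using p by (intro mult_right_mono) (simp_all add: field_simps)
  finally have *: "?c / 4 * ?h \<le> (\<Sum>i\<in>I. (lin_fun p (snd (z i)) u)\<^sup>2)" by simp
  also have "\<dots> = (\<Sum>i\<in>I. (lin_fun p (snd (z i)) v)\<^sup>2) / sqnorm p v"
    by (simp add: u_def lin_fun_scale power_mult_distrib r sum_divide_distrib)
  finally show ?thesis using pos by (simp add: field_simps)
qed

section \<open>The pilot estimator\<close>

text \<open>Candidates for the pilot vector. They are rational in order to be countably many, so that
choosing the first acceptable one is a measurable operation.\<close>

definition sparse_rats :: "nat \<Rightarrow> nat \<Rightarrow> (nat \<Rightarrow> real) set" where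
  "sparse_rats p k = {b \<in> {..<p} \<rightarrow>\<^sub>E \<rat>. l0_norm p b \<le> k}"

definition candidate :: "nat \<Rightarrow> nat \<Rightarrow> nat \<Rightarrow> nat \<Rightarrow> real" where
  "candidate p k = from_nat_into (sparse_rats p k)"

definition rss :: "nat \<Rightarrow> nat set \<Rightarrow> (nat \<Rightarrow> real) \<Rightarrow> sample \<Rightarrow> real" where
  "rss p I b z = (\<Sum>i\<in>I. (resid p b (z i))\<^sup>2)"

text \<open>If no candidate meets the level t, the value of LEAST is arbitrary. This can only happen on the
exceptional event of \<open>pilot_accurate_with_high_probability\<close>.\<close>

definition pilot_index :: "nat \<Rightarrow> nat \<Rightarrow> nat set \<Rightarrow> real \<Rightarrow> sample \<Rightarrow> nat" where
  "pilot_index p k I t z = (LEAST m. rss p I (candidate p k m) z \<le> t)"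

definition pilot :: "nat \<Rightarrow> nat \<Rightarrow> nat set \<Rightarrow> real \<Rightarrow> sample \<Rightarrow> nat \<Rightarrow> real" where
  "pilot p k I t z = candidate p k (pilot_index p k I t z)"

lemma countable_sparse_rats: "countable (sparse_rats p k)"
proof -
  have "countable ({..<p} \<rightarrow>\<^sub>E (\<rat> :: real set))"
    by (intro countable_PiE) (auto simp: countable_rat)
  then show ?thesis by (rule countable_subset[rotated]) (auto simp: sparse_rats_def)
qed

lemma sparse_rats_approximate:
  assumes \<beta>: "l0_norm p \<beta> \<le> k" and \<eta>: "\<eta> > 0"
  obtains b where "b \<in> sparse_rats p k" "sqnorm p (\<lambda>j. \<beta> j - b j) \<le> \<eta>"
proof -
  define \<epsilon> where "\<epsilon> = sqrt (\<eta> / (real p + 1))"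
  have \<epsilon>: "\<epsilon> > 0" "\<epsilon>\<^sup>2 = \<eta> / (real p + 1)" using \<eta> by (simp_all add: \<epsilon>_def)
  have "\<exists>q\<in>\<rat>. \<bar>t - q\<bar> \<le> \<epsilon> \<and> (t = 0 \<longrightarrow> q = 0)" for t :: real
  proof (cases "t = 0")
    case True
    then show ?thesis using \<epsilon> by (intro bexI[of _ 0]) auto
  next
    case False
    obtain q where "q \<in> \<rat>" "t < q" "q < t + \<epsilon>"
      using Rats_dense_in_real[of t "t + \<epsilon>"] \<epsilon> by auto
    then show ?thesis using False by (intro bexI[of _ q]) auto
  qed
  then obtain r where r: "\<And>t. r t \<in> \<rat>" "\<And>t. \<bar>t - r t\<bar> \<le> \<epsilon>" "r 0 = 0"
    by metis
  define b where "b = (\<lambda>j\<in>{..<p}. r (\<beta> j))"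
  have "vec_supp p b \<subseteq> vec_supp p \<beta>"
    using r(3) by (auto simp: vec_supp_def b_def)
  then have "l0_norm p b \<le> l0_norm p \<beta>"
    unfolding l0_norm_def by (intro card_mono) (auto simp: vec_supp_def)
  then have "b \<in> sparse_rats p k"
    using \<beta> r(1) by (auto simp: sparse_rats_def b_def)
  moreover have "sqnorm p (\<lambda>j. \<beta> j - b j) \<le> (\<Sum>j<p. \<epsilon>\<^sup>2)"
    unfolding sqnorm_def
  proof (rule sum_mono)
    fix j assume "j \<in> {..<p}"
    then have "\<bar>\<beta> j - b j\<bar> \<le> \<epsilon>" using r(2) by (simp add: b_def)
    then have "\<bar>\<beta> j - b j\<bar>\<^sup>2 \<le> \<epsilon>\<^sup>2" by (rule power_mono) simp
    then show "(\<beta> j - b j)\<^sup>2 \<le> \<epsilon>\<^sup>2" by simp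
  qed
  then have "sqnorm p (\<lambda>j. \<beta> j - b j) \<le> \<eta>"
  proof (rule order_trans)
    show "(\<Sum>j<p. \<epsilon>\<^sup>2) \<le> \<eta>" using \<eta> by (simp add: \<epsilon>(2) field_simps)
  qed
  ultimately show ?thesis using that by blast
qed

lemma sparse_rats_nonempty: "sparse_rats p k \<noteq> {}"
  by (rule sparse_rats_approximate[of p "\<lambda>_. 0" k 1]) (auto simp: l0_norm_def vec_supp_def)

lemma candidate_in: "candidate p k m \<in> sparse_rats p k"
  unfolding candidate_def by (rule from_nat_into[OF sparse_rats_nonempty])

lemma ex_candidate:
  assumes "b \<in> sparse_rats p k"
  obtains m where "candidate p k m = b"
  using from_nat_into_surj[OF countable_sparse_rats assms] by (auto simp: candidate_def)

lemma pilot_rss_le: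
  assumes "b \<in> sparse_rats p k" "rss p I b z \<le> t"
  shows "rss p I (pilot p k I t z) z \<le> t"
proof -
  obtain m where "candidate p k m = b" using ex_candidate[OF assms(1)] .
  then have "rss p I (candidate p k m) z \<le> t" using assms(2) by simp
  from LeastI[where P="\<lambda>m. rss p I (candidate p k m) z \<le> t", OF this] show ?thesis
    by (simp only: pilot_def pilot_index_def)
qed

lemma resid_eq: "resid p b z = resid p \<beta> z + lin_fun p (snd z) (\<lambda>j. \<beta> j - b j)"
  by (simp add: resid_def lin_fun_diff[symmetric])

lemma rss_le:
  "rss p I b z \<le> 2 * rss p I \<beta> z + 2 * (\<Sum>i\<in>I. (lin_fun p (snd (z i)) (\<lambda>j. \<beta> j - b j))\<^sup>2)"
proof -
  have "rss p I b z \<le> (\<Sum>i\<in>I. 2 * (resid p \<beta> (z i))\<^sup>2 + 2 * (lin_fun p (snd (z i)) (\<lambda>j. \<beta> j - b j))\<^sup>2)"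
    unfolding rss_def
  proof (rule sum_mono)
    fix i
    show "(resid p b (z i))\<^sup>2 \<le> 2 * (resid p \<beta> (z i))\<^sup>2 + 2 * (lin_fun p (snd (z i)) (\<lambda>j. \<beta> j - b j))\<^sup>2"
      using square_sum_le unfolding resid_eq[of p b _ \<beta>] .
  qed
  then show ?thesis by (simp add: rss_def sum.distrib sum_distrib_left)
qed

lemma design_le_rss:
  "(\<Sum>i\<in>I. (lin_fun p (snd (z i)) (\<lambda>j. \<beta> j - b j))\<^sup>2) \<le> 2 * rss p I b z + 2 * rss p I \<beta> z"
proof -
  have "(\<Sum>i\<in>I. (lin_fun p (snd (z i)) (\<lambda>j. \<beta> j - b j))\<^sup>2) \<le> (\<Sum>i\<in>I. 2 * (resid p b (z i))\<^sup>2 + 2 * (resid p \<beta> (z i))\<^sup>2)"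
  proof (rule sum_mono)
    fix i
    show "(lin_fun p (snd (z i)) (\<lambda>j. \<beta> j - b j))\<^sup>2 \<le> 2 * (resid p b (z i))\<^sup>2 + 2 * (resid p \<beta> (z i))\<^sup>2"
      using square_sum_le[of "resid p b (z i)" "- resid p \<beta> (z i)"] resid_eq[of p b "z i" \<beta>] by simp
  qed
  then show ?thesis by (simp add: rss_def sum.distrib sum_distrib_left)
qed

lemma card_vec_supp_diff:
  assumes "l0_norm p v \<le> k" "l0_norm p w \<le> k"
  shows "card (vec_supp p (\<lambda>j. v j - w j)) \<le> 2 * k"
proof -
  have "vec_supp p (\<lambda>j. v j - w j) \<subseteq> vec_supp p v \<union> vec_supp p w"
    by (auto simp: vec_supp_def)
  then have "card (vec_supp p (\<lambda>j. v j - w j)) \<le> card (vec_supp p v \<union> vec_supp p w)"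
    by (intro card_mono) (auto simp: vec_supp_def)
  also have "\<dots> \<le> card (vec_supp p v) + card (vec_supp p w)" by (rule card_Un_le)
  finally show ?thesis using assms by (simp add: l0_norm_def)
qed

text \<open>The level per observation: twice the bound K \<sigma>^2 for the noise, plus 1 for replacing \<beta> by a
nearby rational vector.\<close>

definition pilot_level :: "real \<Rightarrow> real \<Rightarrow> real" where
  "pilot_level K \<sigma> = 2 * K * \<sigma>\<^sup>2 + 1"

definition pilot_error :: "real \<Rightarrow> real \<Rightarrow> real" where
  "pilot_error K \<sigma> = (24 * K * \<sigma>\<^sup>2 + 8) / small_ball_const"

text \<open>Both \<beta> and the pilot leave residuals of squared length O(card I), so the design maps their
difference, which is 2k-sparse, to a vector of squared length O(card I), and the lower isometry
bounds the difference itself. The bound \<open>pilot_error\<close> does not depend on n, p and k.\<close>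

lemma pilot_accurate:
  assumes p: "p \<ge> 2" "4 * K \<le> small_ball_const * (real p)\<^sup>2" and I: "finite I" "I \<noteq> {}" and K: "K > 0"
    and \<beta>: "l0_norm p \<beta> \<le> k"
    and frob: "(\<Sum>i\<in>I. sqnorm p (snd (z i))) \<le> K * real (card I) * real p"
    and grid: "\<And>f. f \<in> grid_index p (2 * k) \<Longrightarrow> sqnorm p (grid_vec p (2 * k) f) \<ge> 1 / 4 \<Longrightarrow>
        small_ball_const * real (card I) \<le> (\<Sum>i\<in>I. (lin_fun p (snd (z i)) (grid_vec p (2 * k) f))\<^sup>2)"
    and noise: "rss p I \<beta> z \<le> K * \<sigma>\<^sup>2 * real (card I)"
  shows "sqnorm p (\<lambda>j. \<beta> j - pilot p k I (pilot_level K \<sigma> * real (card I)) z j) \<le> pilot_error K \<sigma>"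
proof -
  let ?h = "real (card I)" and ?c = small_ball_const
  let ?t = "pilot_level K \<sigma> * ?h"
  have h: "?h > 0" using I by (simp add: card_gt_0_iff)
  \<comment> \<open>rounding \<beta> with squared error \<eta> costs at most card I / 2 in the design norm\<close>
  define \<eta> where "\<eta> = 1 / (2 * K * real p)"
  have \<eta>: "\<eta> > 0" using p K by (simp add: \<eta>_def)
  obtain b where b: "b \<in> sparse_rats p k" "sqnorm p (\<lambda>j. \<beta> j - b j) \<le> \<eta>"
    using sparse_rats_approximate[OF \<beta> \<eta>] .
  have "(\<Sum>i\<in>I. (lin_fun p (snd (z i)) (\<lambda>j. \<beta> j - b j))\<^sup>2) \<le> (\<Sum>i\<in>I. sqnorm p (snd (z i)) * \<eta>)"
  proof (rule sum_mono)
    fix i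
    have "sqnorm p (snd (z i)) * sqnorm p (\<lambda>j. \<beta> j - b j) \<le> sqnorm p (snd (z i)) * \<eta>"
      using b(2) by (rule mult_left_mono) simp
    with lin_fun_square_le show "(lin_fun p (snd (z i)) (\<lambda>j. \<beta> j - b j))\<^sup>2 \<le> sqnorm p (snd (z i)) * \<eta>"
      by (rule order_trans)
  qed
  also have "\<dots> \<le> (K * ?h * real p) * \<eta>"
    using frob \<eta> by (simp add: sum_distrib_right[symmetric] mult_right_mono)
  also have "\<dots> = ?h / 2" using K p by (simp add: \<eta>_def)
  finally have "rss p I b z \<le> ?t"
    using rss_le[of p I b z \<beta>] noise by (simp add: pilot_level_def algebra_simps)
  from pilot_rss_le[OF b(1) this] have fit: "rss p I (pilot p k I ?t z) z \<le> ?t" .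
  let ?b = "pilot p k I ?t z"
  have "l0_norm p ?b \<le> k"
    using candidate_in[of p k "pilot_index p k I ?t z"] by (simp add: sparse_rats_def pilot_def)
  with \<beta> have supp: "card (vec_supp p (\<lambda>j. \<beta> j - ?b j)) \<le> 2 * k" by (rule card_vec_supp_diff)
  have "?c / 4 * ?h * sqnorm p (\<lambda>j. \<beta> j - ?b j) \<le> (\<Sum>i\<in>I. (lin_fun p (snd (z i)) (\<lambda>j. \<beta> j - ?b j))\<^sup>2)"
    by (rule restricted_lower_isometry[OF p I(1) frob grid supp])
  also have "\<dots> \<le> 2 * ?t + 2 * (K * \<sigma>\<^sup>2 * ?h)"
    using design_le_rss[of p z \<beta> ?b I] fit noise by linarith
  also have "\<dots> = (6 * K * \<sigma>\<^sup>2 + 2) * ?h"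
    by (simp add: pilot_level_def algebra_simps)
  finally have "?h * (?c / 4 * sqnorm p (\<lambda>j. \<beta> j - ?b j)) \<le> ?h * (6 * K * \<sigma>\<^sup>2 + 2)"
    by (simp add: ac_simps)
  then have "?c / 4 * sqnorm p (\<lambda>j. \<beta> j - ?b j) \<le> 6 * K * \<sigma>\<^sup>2 + 2"
    using h by (rule mult_left_le_imp_le)
  then show ?thesis
    using small_ball_const_pos by (simp add: pilot_error_def field_simps)
qed

text \<open>Markov's inequality for the noise and for the Frobenius norm of the design gives 1 / K each; the
last term is the union bound over the grid for 2k-sparse vectors.\<close>

lemma pilot_accurate_with_high_probability:
  assumes \<sigma>: "\<sigma> > 0" and p: "p \<ge> 3" "4 * K \<le> small_ball_const * (real p)\<^sup>2" and I: "finite I" "I \<noteq> {}" and K: "K > 0"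
    and \<beta>: "l0_norm p \<beta> \<le> k"
  obtains B where "B \<in> sets (Pi\<^sub>M I (\<lambda>_. row_law p \<beta> \<sigma>))"
    "measure (Pi\<^sub>M I (\<lambda>_. row_law p \<beta> \<sigma>)) B \<le> 2 / K + real p ^ (8 * k) * exp (- real (card I))"
    "\<And>z. z \<in> space (Pi\<^sub>M I (\<lambda>_. row_law p \<beta> \<sigma>)) - B \<Longrightarrow>
       sqnorm p (\<lambda>j. \<beta> j - pilot p k I (pilot_level K \<sigma> * real (card I)) z j) \<le> pilot_error K \<sigma>"
proof -
  let ?R = "row_law p \<beta> \<sigma>" and ?P = "Pi\<^sub>M I (\<lambda>_. row_law p \<beta> \<sigma>)" and ?h = "real (card I)"
  have R: "prob_space ?R" by (rule prob_space_row_law[OF \<sigma>])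
  interpret prob_space ?P by (rule prob_space_PiM[OF R])
  have h: "?h > 0" using I by (simp add: card_gt_0_iff)
  let ?G = "grid_index p (2 * k)"
  let ?v = "grid_vec p (2 * k)"
  define B1 where "B1 = {z \<in> space ?P. K * ?h * real p \<le> (\<Sum>i\<in>I. sqnorm p (snd (z i)))}"
  define B2 where "B2 = {z \<in> space ?P. K * \<sigma>\<^sup>2 * ?h \<le> (\<Sum>i\<in>I. (resid p \<beta> (z i))\<^sup>2)}"
  define B3 where "B3 f = {z \<in> space ?P. (\<Sum>i\<in>I. (lin_fun p (snd (z i)) (?v f))\<^sup>2) \<le> small_ball_const * ?h}" for f
  define F where "F = {f \<in> ?G. sqnorm p (?v f) \<ge> 1 / 4}"
  have finF: "finite F" using finite_grid_index by (simp add: F_def)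
  have "integrable ?P (\<lambda>z. \<Sum>i\<in>I. sqnorm p (snd (z i)))"
    by (intro Bochner_Integration.integrable_sum
        integrable.intros[OF has_bochner_integral_PiM_component[OF R _ has_bochner_integral_design_square[OF \<sigma>]]])
  moreover have "integrable ?P (\<lambda>z. \<Sum>i\<in>I. (resid p \<beta> (z i))\<^sup>2)"
    by (intro Bochner_Integration.integrable_sum
        integrable.intros[OF has_bochner_integral_PiM_component[OF R _ has_bochner_integral_resid_true_square[OF \<sigma>]]])
  ultimately have meas: "(\<lambda>z. \<Sum>i\<in>I. sqnorm p (snd (z i))) \<in> borel_measurable ?P"
    "(\<lambda>z. \<Sum>i\<in>I. (resid p \<beta> (z i))\<^sup>2) \<in> borel_measurable ?P"
    by (simp_all only: borel_measurable_integrable)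
  have B: "B1 \<in> sets ?P" "B2 \<in> sets ?P" "B3 f \<in> sets ?P" for f
    unfolding B1_def B2_def B3_def
    by (intro borel_measurable_le borel_measurable_const meas measurable_design_square)+
  have P1: "measure ?P B1 \<le> 1 / K"
  proof -
    have "measure ?P B1 \<le> ?h * real p / (K * ?h * real p)"
      unfolding B1_def using K h p
      by (intro Markov_PiM_sum[OF R has_bochner_integral_design_square[OF \<sigma>]]) auto
    then show ?thesis using h p by simp
  qed
  have P2: "measure ?P B2 \<le> 1 / K"
  proof -
    have "measure ?P B2 \<le> ?h * \<sigma>\<^sup>2 / (K * \<sigma>\<^sup>2 * ?h)"
      unfolding B2_def using K h \<sigma>
      by (intro Markov_PiM_sum[OF R has_bochner_integral_resid_true_square[OF \<sigma>]]) auto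
    then show ?thesis using h \<sigma> by simp
  qed
  have P3: "measure ?P (\<Union>f\<in>F. B3 f) \<le> real p ^ (8 * k) * exp (- ?h)"
  proof -
    have "measure ?P (\<Union>f\<in>F. B3 f) \<le> (\<Sum>f\<in>F. measure ?P (B3 f))"
      using B(3) by (intro finite_measure_subadditive_finite finF) auto
    also have "\<dots> \<le> (\<Sum>f\<in>F. exp (- ?h))"
      unfolding B3_def by (intro sum_mono small_ball_fixed_direction[OF \<sigma> I(1)]) (simp add: F_def)
    also have "\<dots> = real (card F) * exp (- ?h)" by simp
    also have "real (card F) \<le> real p ^ (8 * k)"
    proof -
      have "card F \<le> card ?G" by (intro card_mono finite_grid_index) (auto simp: F_def)
      also have "\<dots> \<le> p ^ (4 * (2 * k))" by (rule card_grid_index[OF p(1)])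
      finally show ?thesis by (simp flip: of_nat_power)
    qed
    finally show ?thesis by (simp add: mult_right_mono)
  qed
  let ?B = "B1 \<union> B2 \<union> (\<Union>f\<in>F. B3 f)"
  have BF: "(\<Union>f\<in>F. B3 f) \<in> sets ?P" by (intro sets.finite_UN finF B)
  have B12: "B1 \<union> B2 \<in> sets ?P" by (intro sets.Un B)
  have "measure ?P ?B \<le> measure ?P (B1 \<union> B2) + measure ?P (\<Union>f\<in>F. B3 f)"
    by (rule measure_Un_le[OF B12 BF])
  also have "measure ?P (B1 \<union> B2) \<le> measure ?P B1 + measure ?P B2"
    by (rule measure_Un_le[OF B(1,2)])
  finally have small: "measure ?P ?B \<le> 2 / K + real p ^ (8 * k) * exp (- ?h)"
    using P1 P2 P3 by simp
  show thesis
  proof (rule that[OF sets.Un[OF B12 BF] small])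
    fix z assume z: "z \<in> space ?P - ?B"
    show "sqnorm p (\<lambda>j. \<beta> j - pilot p k I (pilot_level K \<sigma> * ?h) z j) \<le> pilot_error K \<sigma>"
    proof (rule pilot_accurate[OF _ p(2) I K \<beta>])
      show "(\<Sum>i\<in>I. sqnorm p (snd (z i))) \<le> K * ?h * real p" using z by (auto simp: B1_def)
      show "rss p I \<beta> z \<le> K * \<sigma>\<^sup>2 * ?h" using z by (auto simp: B2_def rss_def)
      show "small_ball_const * ?h \<le> (\<Sum>i\<in>I. (lin_fun p (snd (z i)) (?v f))\<^sup>2)"
        if f: "f \<in> ?G" "sqnorm p (?v f) \<ge> 1 / 4" for f
      proof -
        have "z \<notin> B3 f" using z f by (auto simp: F_def)
        then show ?thesis using z by (auto simp: B3_def)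
      qed
    qed (use p in simp)
  qed
qed

section \<open>The confidence interval\<close>

text \<open>The plug-in value \<xi> . b plus an estimate of its error from the observations in J.\<close>

definition debiased :: "nat \<Rightarrow> nat set \<Rightarrow> (nat \<Rightarrow> real) \<Rightarrow> (nat \<Rightarrow> real) \<Rightarrow> sample \<Rightarrow> real" where
  "debiased p J \<xi> b z = lin_fun p \<xi> b + (\<Sum>i\<in>J. lin_fun p (snd (z i)) \<xi> * resid p b (z i)) / real (card J)"

lemma measurable_rss:
  assumes "I \<subseteq> A"
  shows "rss p I b \<in> borel_measurable (Pi\<^sub>M A (\<lambda>_. row_space p))"
  unfolding rss_def
proof (intro borel_measurable_sum borel_measurable_power)
  fix i assume "i \<in> I"
  then have i: "i \<in> A" using assms by auto
  show "(\<lambda>z. resid p b (z i)) \<in> borel_measurable (Pi\<^sub>M A (\<lambda>_. row_space p))"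
    by (rule measurable_compose[OF measurable_component_singleton[OF i] measurable_resid])
qed

lemma measurable_debiased:
  assumes "J \<subseteq> A"
  shows "debiased p J \<xi> b \<in> borel_measurable (Pi\<^sub>M A (\<lambda>_. row_space p))"
  unfolding debiased_def
proof (intro borel_measurable_add borel_measurable_divide borel_measurable_const borel_measurable_sum borel_measurable_times)
  fix i assume "i \<in> J"
  then have i: "i \<in> A" using assms by auto
  show "(\<lambda>z. resid p b (z i)) \<in> borel_measurable (Pi\<^sub>M A (\<lambda>_. row_space p))"
    by (rule measurable_compose[OF measurable_component_singleton[OF i] measurable_resid])
  show "(\<lambda>z. lin_fun p (snd (z i)) \<xi>) \<in> borel_measurable (Pi\<^sub>M A (\<lambda>_. row_space p))"
    by (rule measurable_compose[OF measurable_component_singleton[OF i] measurable_lin_fun_snd])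
qed

lemma measurable_pilot_index:
  assumes "I \<subseteq> A"
  shows "pilot_index p k I t \<in> Pi\<^sub>M A (\<lambda>_. row_space p) \<rightarrow>\<^sub>M count_space UNIV"
  unfolding pilot_index_def
proof (rule measurable_Least)
  fix m
  have "{z \<in> space (Pi\<^sub>M A (\<lambda>_. row_space p)). rss p I (candidate p k m) z \<le> t} \<in> sets (Pi\<^sub>M A (\<lambda>_. row_space p))"
    by (intro borel_measurable_le borel_measurable_const measurable_rss assms)
  then show "(\<lambda>z. rss p I (candidate p k m) z \<le> t) \<in> Pi\<^sub>M A (\<lambda>_. row_space p) \<rightarrow>\<^sub>M count_space UNIV"
    by (simp only: pred_def)
qed

lemma measurable_debiased_pilot:
  assumes "I \<subseteq> A" "J \<subseteq> A"
  shows "(\<lambda>z. debiased p J \<xi> (pilot p k I t z) z) \<in> borel_measurable (Pi\<^sub>M A (\<lambda>_. row_space p))"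
  unfolding pilot_def
  by (rule measurable_compose_countable[OF measurable_debiased measurable_pilot_index]) (use assms in auto)

lemma rss_cong: "(\<And>i. i \<in> I \<Longrightarrow> z i = z' i) \<Longrightarrow> rss p I b z = rss p I b z'"
  unfolding rss_def by (intro sum.cong) auto

lemma pilot_cong: "(\<And>i. i \<in> I \<Longrightarrow> z i = z' i) \<Longrightarrow> pilot p k I t z = pilot p k I t z'"
  unfolding pilot_def pilot_index_def using rss_cong[of I z z' p] by presburger

lemma debiased_cong: "(\<And>i. i \<in> J \<Longrightarrow> z i = z' i) \<Longrightarrow> debiased p J \<xi> b z = debiased p J \<xi> b z'"
  unfolding debiased_def by (simp cong: sum.cong)

definition score_const :: "real \<Rightarrow> real \<Rightarrow> real" where
  "score_const D \<sigma> = 2 + 12 * (D\<^sup>2 + \<sigma> ^ 4)"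

lemma debiased_deviation:
  assumes \<sigma>: "\<sigma> > 0" and J: "finite J" "J \<noteq> {}" and s: "sqnorm p \<xi> > 0"
    and D: "sqnorm p (\<lambda>j. \<beta> j - b j) \<le> D" and r: "r > 0"
  shows "measure (Pi\<^sub>M J (\<lambda>_. row_law p \<beta> \<sigma>))
      {z \<in> space (Pi\<^sub>M J (\<lambda>_. row_law p \<beta> \<sigma>)). r \<le> \<bar>debiased p J \<xi> b z - lin_fun p \<xi> \<beta>\<bar>}
    \<le> sqnorm p \<xi> * score_const D \<sigma> / (real (card J) * r\<^sup>2)"
proof -
  let ?R = "row_law p \<beta> \<sigma>" and ?P = "Pi\<^sub>M J (\<lambda>_. row_law p \<beta> \<sigma>)" and ?m = "real (card J)"
  have R: "prob_space ?R" by (rule prob_space_row_law[OF \<sigma>])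
  interpret R: prob_space ?R by (rule R)
  have m: "?m > 0" using J by (simp add: card_gt_0_iff)
  let ?f = "\<lambda>z. lin_fun p (snd z) \<xi> * resid p b z"
  define \<mu> where "\<mu> = lin_fun p \<xi> \<beta> - lin_fun p \<xi> b"
  define g where "g = (\<lambda>z. ?f z - \<mu>)"
  have f: "integrable ?R ?f" "(\<integral>z. ?f z \<partial>?R) = \<mu>"
    using has_bochner_integral_score[OF \<sigma>, of p \<beta> \<xi> b] by (simp_all add: has_bochner_integral_iff \<mu>_def)
  have f2: "integrable ?R (\<lambda>z. (?f z)\<^sup>2)" "(\<integral>z. (?f z)\<^sup>2 \<partial>?R) \<le> sqnorm p \<xi> * score_const D \<sigma>"
    using score_second_moment[OF \<sigma> s D] by (simp_all add: score_const_def)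
  have g: "integrable ?R g" "(\<integral>z. g z \<partial>?R) = 0"
    using f by (simp_all add: g_def R.prob_space)
  have g2: "integrable ?R (\<lambda>z. (g z)\<^sup>2)"
    using f f2 by (simp add: g_def power2_diff)
  have V: "(\<integral>z. (g z)\<^sup>2 \<partial>?R) \<le> sqnorm p \<xi> * score_const D \<sigma>"
  proof -
    have "(\<integral>z. (g z)\<^sup>2 \<partial>?R) = (\<integral>z. (?f z)\<^sup>2 \<partial>?R) - \<mu>\<^sup>2"
      using R.variance_eq[OF f(1) f2(1)] by (simp add: g_def f(2))
    also have "\<dots> \<le> (\<integral>z. (?f z)\<^sup>2 \<partial>?R)" by simp
    finally show ?thesis using f2(2) by simp
  qed
  have eq: "debiased p J \<xi> b z - lin_fun p \<xi> \<beta> = (\<Sum>i\<in>J. g (z i)) / ?m" for z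
  proof -
    have "(\<Sum>i\<in>J. g (z i)) = (\<Sum>i\<in>J. ?f (z i)) - ?m * \<mu>"
      by (simp add: g_def sum_subtractf)
    then show ?thesis using m by (simp add: debiased_def \<mu>_def diff_divide_distrib)
  qed
  have "{z \<in> space ?P. r \<le> \<bar>debiased p J \<xi> b z - lin_fun p \<xi> \<beta>\<bar>} = {z \<in> space ?P. r * ?m \<le> \<bar>\<Sum>i\<in>J. g (z i)\<bar>}"
    unfolding eq using m by (simp add: pos_le_divide_eq)
  then have "measure ?P {z \<in> space ?P. r \<le> \<bar>debiased p J \<xi> b z - lin_fun p \<xi> \<beta>\<bar>}
      \<le> ?m * (sqnorm p \<xi> * score_const D \<sigma>) / (r * ?m)\<^sup>2"
    using Chebyshev_PiM_sum[OF R J(1) g(1) g2 g(2) V, of "r * ?m"] r m by simp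
  also have "\<dots> = sqnorm p \<xi> * score_const D \<sigma> / (?m * r\<^sup>2)"
    using m r by (simp add: power2_eq_square)
  finally show ?thesis .
qed

text \<open>Given the observations in I, the pilot is a fixed vector and the observations in J are still
i.i.d., so \<open>debiased_deviation\<close> applies to each slice of the product. The error budget is \<alpha> / 4 for
Markov's inequalities (K = 8 / \<alpha>), \<alpha> / 4 for the grid and \<alpha> / 2 for Chebyshev's inequality.\<close>

lemma sample_split_coverage:
  assumes \<sigma>: "\<sigma> > 0" and \<alpha>: "0 < \<alpha>" and p: "p \<ge> 3" "32 / \<alpha> \<le> small_ball_const * (real p)\<^sup>2"
    and IJ: "finite I" "I \<noteq> {}" "finite J" "J \<noteq> {}" "I \<inter> J = {}" "I \<union> J = {..<n}"
    and \<beta>: "l0_norm p \<beta> \<le> k" and s: "sqnorm p \<xi> > 0" and r: "r > 0"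
    and small: "real p ^ (8 * k) * exp (- real (card I)) \<le> \<alpha> / 4"
    and wide: "2 * sqnorm p \<xi> * score_const (pilot_error (8 / \<alpha>) \<sigma>) \<sigma> \<le> \<alpha> * (real (card J) * r\<^sup>2)"
  shows "emeasure (law n p (\<beta>, 1\<^sub>m p, \<sigma>)) {z \<in> space (sample_space n p).
      r \<le> \<bar>debiased p J \<xi> (pilot p k I (pilot_level (8 / \<alpha>) \<sigma> * real (card I)) z) z - lin_fun p \<xi> \<beta>\<bar>} \<le> ennreal \<alpha>"
proof -
  let ?R = "row_law p \<beta> \<sigma>" and ?K = "8 / \<alpha>"
  let ?PI = "Pi\<^sub>M I (\<lambda>_. ?R)" and ?PJ = "Pi\<^sub>M J (\<lambda>_. ?R)"
  let ?t = "pilot_level ?K \<sigma> * real (card I)" and ?D = "pilot_error ?K \<sigma>"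
  interpret R: prob_space ?R by (rule prob_space_row_law[OF \<sigma>])
  interpret product_sigma_finite "\<lambda>_. ?R" ..
  interpret PI: prob_space ?PI by (intro prob_space_PiM R.prob_space_axioms)
  interpret PJ: prob_space ?PJ by (intro prob_space_PiM R.prob_space_axioms)
  have law: "law n p (\<beta>, 1\<^sub>m p, \<sigma>) = Pi\<^sub>M (I \<union> J) (\<lambda>_. ?R)" using law_eq_PiM[OF \<sigma>] IJ(6) by simp
  have sets: "sets (sample_space n p) = sets (Pi\<^sub>M (I \<union> J) (\<lambda>_. ?R))"
    unfolding sample_space_def IJ(6) by (rule sets_PiM_cong[OF refl]) simp
  define A where "A = {z \<in> space (sample_space n p). r \<le> \<bar>debiased p J \<xi> (pilot p k I ?t z) z - lin_fun p \<xi> \<beta>\<bar>}"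
  have "(\<lambda>z. debiased p J \<xi> (pilot p k I ?t z) z) \<in> borel_measurable (sample_space n p)"
    unfolding sample_space_def using IJ(6) by (intro measurable_debiased_pilot) auto
  then have "A \<in> sets (sample_space n p)"
    unfolding A_def by (intro borel_measurable_le borel_measurable_const borel_measurable_abs borel_measurable_diff)
  then have A: "A \<in> sets (Pi\<^sub>M (I \<union> J) (\<lambda>_. ?R))" by (simp only: sets)
  obtain B where B: "B \<in> sets ?PI" "measure ?PI B \<le> 2 / ?K + real p ^ (8 * k) * exp (- real (card I))"
    and good: "\<And>z. z \<in> space ?PI - B \<Longrightarrow> sqnorm p (\<lambda>j. \<beta> j - pilot p k I ?t z j) \<le> ?D"
    using pilot_accurate_with_high_probability[OF \<sigma> p(1) _ IJ(1,2) _ \<beta>, of ?K] p(2) \<alpha> by auto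
  have PB: "emeasure ?PI B \<le> ennreal (\<alpha> / 2)"
  proof -
    have "measure ?PI B \<le> \<alpha> / 2" using B(2) small \<alpha> by simp
    then show ?thesis by (simp add: PI.emeasure_eq_measure ennreal_leI)
  qed
  have slice: "emeasure ?PJ ((\<lambda>y. merge I J (x, y)) -` A \<inter> space ?PJ) \<le> indicator B x + ennreal (\<alpha> / 2)"
    if x: "x \<in> space ?PI" for x
  proof (cases "x \<in> B")
    case True
    have "emeasure ?PJ ((\<lambda>y. merge I J (x, y)) -` A \<inter> space ?PJ) \<le> 1" by (rule PJ.emeasure_le_1)
    also have "\<dots> \<le> indicator B x + ennreal (\<alpha> / 2)" using True by (simp add: add_increasing2)
    finally show ?thesis .
  next
    case False
    let ?b = "pilot p k I ?t x"
    let ?S = "{y \<in> space ?PJ. r \<le> \<bar>debiased p J \<xi> ?b y - lin_fun p \<xi> \<beta>\<bar>}"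
    have D: "sqnorm p (\<lambda>j. \<beta> j - ?b j) \<le> ?D" using good x False by simp
    have pil: "pilot p k I ?t (merge I J (x, y)) = ?b" for y
      by (rule pilot_cong) (simp add: merge_def)
    have deb: "debiased p J \<xi> ?b (merge I J (x, y)) = debiased p J \<xi> ?b y" for y
      using IJ(5) by (intro debiased_cong) (auto simp: merge_def)
    have sub: "(\<lambda>y. merge I J (x, y)) -` A \<inter> space ?PJ \<subseteq> ?S"
      by (auto simp: A_def pil deb)
    have "debiased p J \<xi> ?b \<in> borel_measurable ?PJ"
    proof -
      have "sets ?PJ = sets (Pi\<^sub>M J (\<lambda>_. row_space p))" by (intro sets_PiM_cong) auto
      then show ?thesis
        using measurable_debiased[OF subset_refl] by (subst measurable_cong_sets[OF _ refl])
    qed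
    then have S: "?S \<in> sets ?PJ"
      by (intro borel_measurable_le borel_measurable_const borel_measurable_abs borel_measurable_diff)
    have m: "real (card J) > 0" using IJ by (simp add: card_gt_0_iff)
    have "measure ?PJ ?S \<le> sqnorm p \<xi> * score_const ?D \<sigma> / (real (card J) * r\<^sup>2)"
      by (rule debiased_deviation[OF \<sigma> IJ(3,4) s D r])
    also have "\<dots> \<le> \<alpha> / 2"
      using wide m r by (simp add: field_simps)
    finally have "emeasure ?PJ ?S \<le> ennreal (\<alpha> / 2)"
      by (simp add: PJ.emeasure_eq_measure ennreal_leI)
    with emeasure_mono[OF sub S] have "emeasure ?PJ ((\<lambda>y. merge I J (x, y)) -` A \<inter> space ?PJ) \<le> ennreal (\<alpha> / 2)"
      by (rule order_trans)
    then show ?thesis using False by simp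
  qed
  have "emeasure (Pi\<^sub>M (I \<union> J) (\<lambda>_. ?R)) A
      = (\<integral>\<^sup>+x. emeasure ?PJ ((\<lambda>y. merge I J (x, y)) -` A \<inter> space ?PJ) \<partial>?PI)"
    by (rule emeasure_fold_integral[OF IJ(5,1,3) A])
  also have "\<dots> \<le> (\<integral>\<^sup>+x. indicator B x + ennreal (\<alpha> / 2) \<partial>?PI)"
    by (rule nn_integral_mono[OF slice])
  also have "\<dots> = emeasure ?PI B + ennreal (\<alpha> / 2)"
    using B(1) by (subst nn_integral_add) (simp_all add: PI.emeasure_space_1)
  also have "\<dots> \<le> ennreal (\<alpha> / 2) + ennreal (\<alpha> / 2)"
    using PB by (rule add_right_mono)
  also have "\<dots> = ennreal \<alpha>" using \<alpha> by (simp flip: ennreal_plus)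
  finally show ?thesis unfolding law A_def .
qed

lemma prob_space_law: "\<sigma> > 0 \<Longrightarrow> prob_space (law n p (\<beta>, 1\<^sub>m p, \<sigma>))"
  by (simp add: law_eq_PiM prob_space_PiM prob_space_row_law)

lemma space_law: "space (law n p (\<beta>, 1\<^sub>m p, \<sigma>)) = space (sample_space n p)"
  by (simp add: law_def)

lemma sets_law: "sets (law n p (\<beta>, 1\<^sub>m p, \<sigma>)) = sets (sample_space n p)"
  by (simp add: law_def)

lemma minimax_length_le_fixed_width:
  assumes \<sigma>: "\<sigma> > 0" and \<alpha>: "0 < \<alpha>" "\<alpha> < 1" and r: "r > 0"
    and T: "T \<in> borel_measurable (sample_space n p)"
    and cover: "\<And>\<beta>. l0_norm p \<beta> \<le> k \<Longrightarrow>
      emeasure (law n p (\<beta>, 1\<^sub>m p, \<sigma>)) {z \<in> space (sample_space n p). r \<le> \<bar>T z - F \<beta>\<bar>} \<le> ennreal \<alpha>"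
  shows "minimax_length n p \<alpha> (param_known p k \<sigma>) F \<le> ennreal (2 * r)"
proof -
  let ?S = "sample_space n p"
  let ?CI = "(\<lambda>z. T z - r, \<lambda>z. T z + r)"
  have "?CI \<in> conf_intervals n p \<alpha> (param_known p k \<sigma>) F"
    unfolding conf_intervals_def
  proof (safe)
    show "(\<lambda>z. T z - r) \<in> borel_measurable ?S" "(\<lambda>z. T z + r) \<in> borel_measurable ?S"
      using T by (intro borel_measurable_diff borel_measurable_add borel_measurable_const; assumption)+
    show "T z - r \<le> T z + r" for z using r by simp
    show "ennreal (1 - \<alpha>) \<le> (INF \<theta>\<in>param_known p k \<sigma>.
        emeasure (law n p \<theta>) {z \<in> space ?S. T z - r \<le> F (fst \<theta>) \<and> F (fst \<theta>) \<le> T z + r})"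
    proof (rule INF_greatest)
      fix \<theta> assume "\<theta> \<in> param_known p k \<sigma>"
      then obtain \<beta> where \<theta>: "\<theta> = (\<beta>, 1\<^sub>m p, \<sigma>)" and \<beta>: "l0_norm p \<beta> \<le> k"
        by (auto simp: param_known_def)
      let ?L = "law n p (\<beta>, 1\<^sub>m p, \<sigma>)"
      interpret prob_space ?L by (rule prob_space_law[OF \<sigma>])
      let ?A = "{z \<in> space ?S. r \<le> \<bar>T z - F \<beta>\<bar>}"
      let ?G = "{z \<in> space ?S. T z - r \<le> F \<beta> \<and> F \<beta> \<le> T z + r}"
      have A: "?A \<in> sets ?S"
        using T by (intro borel_measurable_le borel_measurable_const borel_measurable_abs borel_measurable_diff)
      have m: "(\<lambda>z. T z - r) \<in> borel_measurable ?S" "(\<lambda>z. T z + r) \<in> borel_measurable ?S"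
        using T by (intro borel_measurable_diff borel_measurable_add borel_measurable_const; assumption)+
      have "?G = {z \<in> space ?S. T z - r \<le> F \<beta>} \<inter> {z \<in> space ?S. F \<beta> \<le> T z + r}" by auto
      then have G: "?G \<in> sets ?S"
        using m by (simp only:) (intro sets.Int borel_measurable_le borel_measurable_const; assumption)
      have "measure ?L ?A \<le> \<alpha>"
        using cover[OF \<beta>] \<alpha> by (simp add: emeasure_eq_measure)
      moreover have "measure ?L (space ?L - ?A) = 1 - measure ?L ?A"
        using A by (intro prob_compl) (simp only: sets_law)
      ultimately have "1 - \<alpha> \<le> measure ?L (space ?L - ?A)" by simp
      also have "\<dots> \<le> measure ?L ?G"
      proof (rule finite_measure_mono)
        show "?G \<in> sets ?L" using G by (simp only: sets_law)
        show "space ?L - ?A \<subseteq> ?G" unfolding space_law by auto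
      qed
      finally show "ennreal (1 - \<alpha>) \<le> emeasure (law n p \<theta>) {z \<in> space ?S. T z - r \<le> F (fst \<theta>) \<and> F (fst \<theta>) \<le> T z + r}"
        by (simp add: \<theta> emeasure_eq_measure ennreal_leI)
    qed
  qed
  then have "minimax_length n p \<alpha> (param_known p k \<sigma>) F \<le> (SUP \<theta>\<in>param_known p k \<sigma>. expected_length n p \<theta> ?CI)"
    unfolding minimax_length_def by (rule INF_lower)
  also have "\<dots> \<le> ennreal (2 * r)"
  proof (rule SUP_least)
    fix \<theta> assume "\<theta> \<in> param_known p k \<sigma>"
    then obtain \<beta> where \<theta>: "\<theta> = (\<beta>, 1\<^sub>m p, \<sigma>)" by (auto simp: param_known_def)
    interpret prob_space "law n p (\<beta>, 1\<^sub>m p, \<sigma>)" by (rule prob_space_law[OF \<sigma>])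
    have "expected_length n p \<theta> ?CI = (\<integral>\<^sup>+z. ennreal (2 * r) \<partial>law n p (\<beta>, 1\<^sub>m p, \<sigma>))"
      unfolding expected_length_def \<theta> by (simp add: algebra_simps)
    also have "\<dots> = ennreal (2 * r)" by (simp add: emeasure_space_1)
    finally show "expected_length n p \<theta> ?CI \<le> ennreal (2 * r)" by simp
  qed
  finally show ?thesis .
qed

section \<open>Likelihood ratios\<close>

definition zero_coeff :: "nat \<Rightarrow> nat \<Rightarrow> real" where
  "zero_coeff p = (\<lambda>j\<in>{..<p}. 0)"

lemma lin_fun_zero_coeff [simp]: "lin_fun p x (zero_coeff p) = 0"
  by (simp add: lin_fun_def zero_coeff_def)

text \<open>Given x, the response y is normal with mean x . \<beta>.\<close>

lemma nn_integral_row_law: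
  assumes \<sigma>: "\<sigma> > 0" and f: "f \<in> borel_measurable (row_space p)"
  shows "(\<integral>\<^sup>+z. f z \<partial>row_law p \<beta> \<sigma>)
    = (\<integral>\<^sup>+x. \<integral>\<^sup>+y. ennreal (normal_density (lin_fun p x \<beta>) \<sigma> y) * f (y, x) \<partial>lborel \<partial>std_normal_vec p)"
proof -
  interpret E: prob_space "noise \<sigma>" by (rule prob_space_noise[OF \<sigma>])
  have h: "(\<lambda>(x, e). (lin_fun p x \<beta> + e, x)) \<in> std_normal_vec p \<Otimes>\<^sub>M noise \<sigma> \<rightarrow>\<^sub>M row_space p"
    by measurable
  have fx: "(\<lambda>y. f (y, x)) \<in> borel_measurable borel" if "x \<in> space (std_normal_vec p)" for x
  proof -
    have "x \<in> space (Pi\<^sub>M {..<p} (\<lambda>_. borel :: real measure))"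
      using that sets_eq_imp_space_eq[OF sets_std_normal_vec] by blast
    then show ?thesis by (rule measurable_compose[OF measurable_Pair2' f])
  qed
  have "(\<integral>\<^sup>+z. f z \<partial>row_law p \<beta> \<sigma>) = (\<integral>\<^sup>+w. f (case w of (x, e) \<Rightarrow> (lin_fun p x \<beta> + e, x)) \<partial>(std_normal_vec p \<Otimes>\<^sub>M noise \<sigma>))"
    unfolding row_law_def using f by (intro nn_integral_distr[OF h]) simp
  also have "\<dots> = (\<integral>\<^sup>+x. \<integral>\<^sup>+e. f (lin_fun p x \<beta> + e, x) \<partial>noise \<sigma> \<partial>std_normal_vec p)"
    by (subst E.nn_integral_fst[symmetric]) (simp_all add: measurable_compose[OF h f])
  also have "\<dots> = (\<integral>\<^sup>+x. \<integral>\<^sup>+y. ennreal (normal_density (lin_fun p x \<beta>) \<sigma> y) * f (y, x) \<partial>lborel \<partial>std_normal_vec p)"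
  proof (rule nn_integral_cong)
    fix x assume x: "x \<in> space (std_normal_vec p)"
    let ?a = "lin_fun p x \<beta>"
    have m: "(\<lambda>e. f (?a + e, x)) \<in> borel_measurable lborel"
    proof (rule measurable_compose[OF _ fx[OF x]])
      have "(\<lambda>e. a + e) \<in> borel_measurable lborel" for a :: real by simp
      then show "(\<lambda>e. ?a + e) \<in> borel_measurable lborel" .
    qed
    have shift: "normal_density ?a \<sigma> (?a + e) = normal_density 0 \<sigma> e" for e
      by (simp add: normal_density_def)
    have "(\<integral>\<^sup>+e. f (?a + e, x) \<partial>noise \<sigma>) = (\<integral>\<^sup>+e. ennreal (normal_density 0 \<sigma> e) * f (?a + e, x) \<partial>lborel)"
      unfolding noise_def by (rule nn_integral_density[OF _ m]) simp
    also have "\<dots> = (\<integral>\<^sup>+y. ennreal (normal_density ?a \<sigma> y) * f (y, x) \<partial>lborel)"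
      using nn_integral_real_affine[of "\<lambda>y. ennreal (normal_density ?a \<sigma> y) * f (y, x)" 1 ?a] fx[OF x]
      by (simp add: shift)
    finally show "(\<integral>\<^sup>+e. f (?a + e, x) \<partial>noise \<sigma>) = (\<integral>\<^sup>+y. ennreal (normal_density ?a \<sigma> y) * f (y, x) \<partial>lborel)" .
  qed
  finally show ?thesis .
qed

lemma borel_measurable_row_lawI:
  "f \<in> borel_measurable (row_space p) \<Longrightarrow> f \<in> borel_measurable (row_law p \<beta> \<sigma>)"
  by (subst measurable_cong_sets[OF sets_row_law refl])

text \<open>The likelihood ratio of one observation for \<beta> against the zero vector.\<close>

definition row_ratio :: "nat \<Rightarrow> (nat \<Rightarrow> real) \<Rightarrow> real \<Rightarrow> real \<times> (nat \<Rightarrow> real) \<Rightarrow> real" where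
  "row_ratio p \<beta> \<sigma> z = exp ((2 * fst z * lin_fun p (snd z) \<beta> - (lin_fun p (snd z) \<beta>)\<^sup>2) / (2 * \<sigma>\<^sup>2))"

lemma measurable_row_ratio: "row_ratio p \<beta> \<sigma> \<in> borel_measurable (row_space p)"
proof -
  have "(\<lambda>z. (2 * fst z * lin_fun p (snd z) \<beta> - (lin_fun p (snd z) \<beta>)\<^sup>2) / (2 * \<sigma>\<^sup>2)) \<in> borel_measurable (row_space p)"
    by (intro borel_measurable_divide borel_measurable_diff borel_measurable_times borel_measurable_power
      borel_measurable_const measurable_fst measurable_lin_fun_snd)
  then show ?thesis unfolding row_ratio_def by (rule measurable_compose) simp
qed

lemma normal_density_tilt:
  assumes "\<sigma> > 0"
  shows "normal_density 0 \<sigma> y * exp ((2 * y * a - a\<^sup>2) / (2 * \<sigma>\<^sup>2)) = normal_density a \<sigma> y"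
proof -
  have "- y\<^sup>2 / (2 * \<sigma>\<^sup>2) + (2 * y * a - a\<^sup>2) / (2 * \<sigma>\<^sup>2) = - (y - a)\<^sup>2 / (2 * \<sigma>\<^sup>2)"
    by (simp add: add_divide_distrib[symmetric] power2_diff algebra_simps)
  then have "exp (- y\<^sup>2 / (2 * \<sigma>\<^sup>2)) * exp ((2 * y * a - a\<^sup>2) / (2 * \<sigma>\<^sup>2)) = exp (- (y - a)\<^sup>2 / (2 * \<sigma>\<^sup>2))"
    by (simp only: exp_add[symmetric])
  then show ?thesis by (simp add: normal_density_def)
qed

lemma row_law_eq_density:
  assumes \<sigma>: "\<sigma> > 0"
  shows "row_law p \<beta> \<sigma> = density (row_law p (zero_coeff p) \<sigma>) (\<lambda>z. ennreal (row_ratio p \<beta> \<sigma> z))"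
proof (rule measure_eqI)
  let ?R0 = "row_law p (zero_coeff p) \<sigma>"
  show "sets (row_law p \<beta> \<sigma>) = sets (density ?R0 (\<lambda>z. ennreal (row_ratio p \<beta> \<sigma> z)))" by simp
  fix A assume "A \<in> sets (row_law p \<beta> \<sigma>)"
  then have A: "A \<in> sets (row_space p)" by simp
  have r: "(\<lambda>z. ennreal (row_ratio p \<beta> \<sigma> z)) \<in> borel_measurable (row_space p)"
    by (rule measurable_compose[OF measurable_row_ratio measurable_ennreal])
  have ind: "indicator A \<in> (borel_measurable (row_space p) :: (_ \<Rightarrow> ennreal) set)"
    by (rule borel_measurable_indicator[OF A])
  have tilt: "ennreal (normal_density 0 \<sigma> y) * (ennreal (row_ratio p \<beta> \<sigma> (y, x)) * i)
      = ennreal (normal_density (lin_fun p x \<beta>) \<sigma> y) * i" for y x i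
  proof -
    have "normal_density 0 \<sigma> y * row_ratio p \<beta> \<sigma> (y, x) = normal_density (lin_fun p x \<beta>) \<sigma> y"
      using normal_density_tilt[OF \<sigma>, of y "lin_fun p x \<beta>"] by (simp add: row_ratio_def)
    then have "ennreal (normal_density 0 \<sigma> y) * ennreal (row_ratio p \<beta> \<sigma> (y, x)) = ennreal (normal_density (lin_fun p x \<beta>) \<sigma> y)"
      by (simp flip: ennreal_mult')
    then show ?thesis by (simp only: mult.assoc[symmetric])
  qed
  have "emeasure (density ?R0 (\<lambda>z. ennreal (row_ratio p \<beta> \<sigma> z))) A = (\<integral>\<^sup>+z. ennreal (row_ratio p \<beta> \<sigma> z) * indicator A z \<partial>?R0)"
    using r A by (intro emeasure_density borel_measurable_row_lawI) (simp_all only: sets_row_law)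
  also have "\<dots> = (\<integral>\<^sup>+x. \<integral>\<^sup>+y. ennreal (normal_density (lin_fun p x \<beta>) \<sigma> y) * indicator A (y, x) \<partial>lborel \<partial>std_normal_vec p)"
    by (subst nn_integral_row_law[OF \<sigma> borel_measurable_times_ennreal[OF r ind]]) (simp add: tilt)
  also have "\<dots> = (\<integral>\<^sup>+z. indicator A z \<partial>row_law p \<beta> \<sigma>)"
    by (rule nn_integral_row_law[OF \<sigma> ind, symmetric])
  also have "\<dots> = emeasure (row_law p \<beta> \<sigma>) A" using A by simp
  finally show "emeasure (row_law p \<beta> \<sigma>) A = emeasure (density ?R0 (\<lambda>z. ennreal (row_ratio p \<beta> \<sigma> z))) A" ..
qed

text \<open>Given x and with a = x . \<beta>, the squared ratio times the density for mean 0 is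
exp (a^2 / \<sigma>^2) times the density for mean 2 a. What remains is an exponential moment of a^2.\<close>

lemma nn_integral_row_ratio_square:
  assumes \<sigma>: "\<sigma> > 0" and small: "2 * (sqnorm p \<beta> / \<sigma>\<^sup>2) < 1"
  shows "(\<integral>\<^sup>+z. ennreal ((row_ratio p \<beta> \<sigma> z)\<^sup>2) \<partial>row_law p (zero_coeff p) \<sigma>) = ennreal (1 / sqrt (1 - 2 * (sqnorm p \<beta> / \<sigma>\<^sup>2)))"
proof -
  have m: "(\<lambda>z. ennreal ((row_ratio p \<beta> \<sigma> z)\<^sup>2)) \<in> borel_measurable (row_space p)"
    by (rule measurable_compose[OF borel_measurable_power[OF measurable_row_ratio] measurable_ennreal])
  have eq: "ennreal (normal_density 0 \<sigma> y) * ennreal ((row_ratio p \<beta> \<sigma> (y, x))\<^sup>2)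
      = ennreal (exp (1 / \<sigma>\<^sup>2 * (lin_fun p x \<beta>)\<^sup>2)) * ennreal (normal_density (2 * lin_fun p x \<beta>) \<sigma> y)" for x y
  proof -
    let ?a = "lin_fun p x \<beta>"
    have "(row_ratio p \<beta> \<sigma> (y, x))\<^sup>2 = exp (2 * ((2 * y * ?a - ?a\<^sup>2) / (2 * \<sigma>\<^sup>2)))"
      by (simp only: row_ratio_def fst_conv snd_conv exp_double)
    also have "2 * ((2 * y * ?a - ?a\<^sup>2) / (2 * \<sigma>\<^sup>2)) = 1 / \<sigma>\<^sup>2 * ?a\<^sup>2 + (2 * y * (2 * ?a) - (2 * ?a)\<^sup>2) / (2 * \<sigma>\<^sup>2)"
      using \<sigma> by (simp add: field_simps)
    finally have "(row_ratio p \<beta> \<sigma> (y, x))\<^sup>2 = exp (1 / \<sigma>\<^sup>2 * ?a\<^sup>2) * exp ((2 * y * (2 * ?a) - (2 * ?a)\<^sup>2) / (2 * \<sigma>\<^sup>2))"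
      by (simp only: exp_add)
    then have "normal_density 0 \<sigma> y * (row_ratio p \<beta> \<sigma> (y, x))\<^sup>2 = exp (1 / \<sigma>\<^sup>2 * ?a\<^sup>2) * normal_density (2 * ?a) \<sigma> y"
      using normal_density_tilt[OF \<sigma>, of y "2 * ?a"] by simp
    then show ?thesis by (simp flip: ennreal_mult' ennreal_mult'')
  qed
  have "(\<integral>\<^sup>+z. ennreal ((row_ratio p \<beta> \<sigma> z)\<^sup>2) \<partial>row_law p (zero_coeff p) \<sigma>)
      = (\<integral>\<^sup>+x. \<integral>\<^sup>+y. ennreal (exp (1 / \<sigma>\<^sup>2 * (lin_fun p x \<beta>)\<^sup>2)) * ennreal (normal_density (2 * lin_fun p x \<beta>) \<sigma> y) \<partial>lborel \<partial>std_normal_vec p)"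
    by (subst nn_integral_row_law[OF \<sigma> m]) (simp only: lin_fun_zero_coeff eq)
  also have "\<dots> = (\<integral>\<^sup>+x. ennreal (exp (1 / \<sigma>\<^sup>2 * (lin_fun p x \<beta>)\<^sup>2)) \<partial>std_normal_vec p)"
    using \<sigma> by (simp add: nn_integral_cmult nn_integral_eq_integral)
  also have "\<dots> = ennreal (1 / sqrt (1 - 2 * (sqnorm p \<beta> / \<sigma>\<^sup>2)))"
    using nn_integral_exp_square_lin_fun[of "1 / \<sigma>\<^sup>2" p \<beta>] small by simp
  finally show ?thesis .
qed

lemma sample_likelihood_ratio:
  fixes n p :: nat and \<beta> :: "nat \<Rightarrow> real" and \<sigma> :: real
  assumes \<sigma>: "\<sigma> > 0"
  defines "P0 \<equiv> law n p (zero_coeff p, 1\<^sub>m p, \<sigma>)" and "L \<equiv> (\<lambda>z. \<Prod>i<n. row_ratio p \<beta> \<sigma> (z i))"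
  shows "L \<in> borel_measurable P0"
    and "law n p (\<beta>, 1\<^sub>m p, \<sigma>) = density P0 (\<lambda>z. ennreal (L z))"
    and "2 * (sqnorm p \<beta> / \<sigma>\<^sup>2) < 1 \<Longrightarrow> (\<integral>\<^sup>+z. ennreal ((L z)\<^sup>2) \<partial>P0) = ennreal ((1 / sqrt (1 - 2 * (sqnorm p \<beta> / \<sigma>\<^sup>2))) ^ n)"
proof -
  let ?R0 = "row_law p (zero_coeff p) \<sigma>"
  interpret R0: prob_space ?R0 by (rule prob_space_row_law[OF \<sigma>])
  interpret product_sigma_finite "\<lambda>_. ?R0" ..
  have P0: "P0 = Pi\<^sub>M {..<n} (\<lambda>_. ?R0)" unfolding P0_def by (rule law_eq_PiM[OF \<sigma>])
  have m: "row_ratio p \<beta> \<sigma> \<in> borel_measurable ?R0"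
    by (intro borel_measurable_row_lawI measurable_row_ratio)
  have m': "(\<lambda>z. ennreal (row_ratio p \<beta> \<sigma> z)) \<in> borel_measurable ?R0"
    and m2: "(\<lambda>z. ennreal ((row_ratio p \<beta> \<sigma> z)\<^sup>2)) \<in> borel_measurable ?R0"
    by (rule measurable_compose[OF m measurable_ennreal], rule measurable_compose[OF borel_measurable_power[OF m] measurable_ennreal])
  have pos: "row_ratio p \<beta> \<sigma> z \<ge> 0" for z by (simp add: row_ratio_def)
  show "L \<in> borel_measurable P0"
    unfolding L_def P0
    by (rule borel_measurable_prod) (rule measurable_compose[OF measurable_component_singleton[of _ "{..<n}" "\<lambda>_. ?R0"] m])
  have "law n p (\<beta>, 1\<^sub>m p, \<sigma>) = Pi\<^sub>M {..<n} (\<lambda>_. density ?R0 (\<lambda>z. ennreal (row_ratio p \<beta> \<sigma> z)))"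
    unfolding law_eq_PiM[OF \<sigma>] row_law_eq_density[OF \<sigma>, of p \<beta>, symmetric] ..
  also have "\<dots> = density (Pi\<^sub>M {..<n} (\<lambda>_. ?R0)) (\<lambda>z. \<Prod>i<n. ennreal (row_ratio p \<beta> \<sigma> (z i)))"
  proof (intro PiM_density m' R0.sigma_finite_measure_axioms finite_lessThan)
    show "sigma_finite_measure (density ?R0 (\<lambda>z. ennreal (row_ratio p \<beta> \<sigma> z)))"
      using prob_space_imp_sigma_finite[OF prob_space_row_law[OF \<sigma>, of p \<beta>]]
      by (subst (asm) row_law_eq_density[OF \<sigma>])
  qed
  also have "\<dots> = density P0 (\<lambda>z. ennreal (L z))"
    unfolding P0 L_def by (simp add: prod_ennreal pos)
  finally show "law n p (\<beta>, 1\<^sub>m p, \<sigma>) = density P0 (\<lambda>z. ennreal (L z))" .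
  assume small: "2 * (sqnorm p \<beta> / \<sigma>\<^sup>2) < 1"
  have "(\<integral>\<^sup>+z. ennreal ((L z)\<^sup>2) \<partial>P0) = (\<integral>\<^sup>+z. (\<Prod>i<n. ennreal ((row_ratio p \<beta> \<sigma> (z i))\<^sup>2)) \<partial>Pi\<^sub>M {..<n} (\<lambda>_. ?R0))"
    unfolding P0 L_def by (simp add: prod_ennreal prod_power_distrib)
  also have "\<dots> = (\<Prod>i<n. \<integral>\<^sup>+z. ennreal ((row_ratio p \<beta> \<sigma> z)\<^sup>2) \<partial>?R0)"
    by (rule product_nn_integral_prod[OF finite_lessThan m2])
  also have "\<dots> = ennreal ((1 / sqrt (1 - 2 * (sqnorm p \<beta> / \<sigma>\<^sup>2))) ^ n)"
  proof -
    have "0 \<le> 1 / sqrt (1 - 2 * (sqnorm p \<beta> / \<sigma>\<^sup>2))" using small by (intro divide_nonneg_nonneg) simp_all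
    then show ?thesis
      by (simp only: nn_integral_row_ratio_square[OF \<sigma> small] prod_constant card_lessThan ennreal_power)
  qed
  finally show "(\<integral>\<^sup>+z. ennreal ((L z)\<^sup>2) \<partial>P0) = ennreal ((1 / sqrt (1 - 2 * (sqnorm p \<beta> / \<sigma>\<^sup>2))) ^ n)" .
qed

text \<open>A bound on the total variation distance by the chi-square divergence, by integrating the pointwise inequality
(1 - L) 1_B \<le> \<delta> / 2 + (1 - L)^2 / (2 \<delta>).\<close>

lemma measure_le_measure_density_add:
  fixes L :: "'a \<Rightarrow> real"
  assumes M: "prob_space M" and D: "prob_space (density M (\<lambda>z. ennreal (L z)))"
    and L: "L \<in> borel_measurable M" "\<And>z. L z \<ge> 0"
    and second: "(\<integral>\<^sup>+z. ennreal ((L z)\<^sup>2) \<partial>M) \<le> ennreal (1 + \<delta>\<^sup>2)" and \<delta>: "\<delta> > 0" and B: "B \<in> sets M"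
  shows "measure M B \<le> measure (density M (\<lambda>z. ennreal (L z))) B + \<delta>"
proof -
  interpret M: prob_space M by (rule M)
  interpret D: prob_space "density M (\<lambda>z. ennreal (L z))" by (rule D)
  have Lm: "(\<lambda>z. ennreal (L z)) \<in> borel_measurable M"
    by (rule measurable_compose[OF L(1) measurable_ennreal])
  have one: "(\<integral>\<^sup>+z. ennreal (L z) \<partial>M) = 1"
  proof -
    have "emeasure (density M (\<lambda>z. ennreal (L z))) (space M) = (\<integral>\<^sup>+z. ennreal (L z) * indicator (space M) z \<partial>M)"
      by (rule emeasure_density[OF Lm sets.top])
    also have "\<dots> = (\<integral>\<^sup>+z. ennreal (L z) \<partial>M)"
      by (rule nn_integral_cong) simp
    finally show ?thesis using D.emeasure_space_1 by simp
  qed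
  have L1: "integrable M L"
    by (rule integrableI_nonneg[OF L(1)]) (simp_all add: L(2) one)
  have E1: "(\<integral>z. L z \<partial>M) = 1"
  proof -
    have "ennreal (\<integral>z. L z \<partial>M) = 1"
      using nn_integral_eq_integral[OF L1] L(2) by (simp only: one AE_I2)
    then show ?thesis by simp
  qed
  have L2: "integrable M (\<lambda>z. (L z)\<^sup>2)"
  proof (rule integrableI_nonneg[OF borel_measurable_power[OF L(1)]])
    show "(\<integral>\<^sup>+z. ennreal ((L z)\<^sup>2) \<partial>M) < \<infinity>"
      using second by (rule le_less_trans) simp
  qed simp
  have E2: "(\<integral>z. (L z)\<^sup>2 \<partial>M) \<le> 1 + \<delta>\<^sup>2"
  proof -
    have "ennreal (\<integral>z. (L z)\<^sup>2 \<partial>M) \<le> ennreal (1 + \<delta>\<^sup>2)"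
      using second nn_integral_eq_integral[OF L2] by simp
    then show ?thesis by (subst (asm) ennreal_le_iff) simp_all
  qed
  have LB: "measure (density M (\<lambda>z. ennreal (L z))) B = (\<integral>z. L z * indicator B z \<partial>M)"
  proof -
    have "emeasure (density M (\<lambda>z. ennreal (L z))) B = (\<integral>\<^sup>+z. ennreal (L z) * indicator B z \<partial>M)"
      by (rule emeasure_density[OF Lm B])
    also have "\<dots> = (\<integral>\<^sup>+z. ennreal (L z * indicator B z) \<partial>M)"
      by (rule nn_integral_cong) (simp split: split_indicator)
    also have "\<dots> = ennreal (\<integral>z. L z * indicator B z \<partial>M)"
      using L(2) by (intro nn_integral_eq_integral integrable_real_mult_indicator L1 B AE_I2) simp
    finally show ?thesis
      using L(2) by (simp add: measure_def integral_nonneg)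
  qed
  have IB: "integrable M (indicator B :: 'a \<Rightarrow> real)"
    by (rule integrable_real_indicator[OF B]) (simp add: M.emeasure_eq_measure)
  have "measure M B - measure (density M (\<lambda>z. ennreal (L z))) B = (\<integral>z. indicator B z - L z * indicator B z \<partial>M)"
    unfolding LB using integrable_real_mult_indicator[OF B L1] IB B by (subst Bochner_Integration.integral_diff) simp_all
  also have "\<dots> \<le> (\<integral>z. \<delta> / 2 + (1 - 2 * L z + (L z)\<^sup>2) / (2 * \<delta>) \<partial>M)"
  proof (rule integral_mono)
    show "integrable M (\<lambda>z. indicator B z - L z * indicator B z)"
      by (intro Bochner_Integration.integrable_diff integrable_real_mult_indicator L1 B IB)
    show "integrable M (\<lambda>z. \<delta> / 2 + (1 - 2 * L z + (L z)\<^sup>2) / (2 * \<delta>))"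
      using L1 L2 by simp
    fix z
    have "0 \<le> (\<delta> - (1 - L z))\<^sup>2 / (2 * \<delta>)" using \<delta> by simp
    also have "\<dots> = \<delta> / 2 + (1 - 2 * L z + (L z)\<^sup>2) / (2 * \<delta>) - (1 - L z)"
      using \<delta> by (simp add: power2_eq_square field_simps)
    finally have "1 - L z \<le> \<delta> / 2 + (1 - 2 * L z + (L z)\<^sup>2) / (2 * \<delta>)" by simp
    moreover have "0 \<le> \<delta> / 2 + (1 - 2 * L z + (L z)\<^sup>2) / (2 * \<delta>)"
    proof -
      have "1 - 2 * L z + (L z)\<^sup>2 = (1 - L z)\<^sup>2" by (simp add: power2_diff)
      then show ?thesis using \<delta> by simp
    qed
    ultimately show "indicator B z - L z * indicator B z \<le> \<delta> / 2 + (1 - 2 * L z + (L z)\<^sup>2) / (2 * \<delta>)"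
      by (simp add: indicator_def)
  qed
  also have "\<dots> = \<delta> / 2 + ((\<integral>z. (L z)\<^sup>2 \<partial>M) - 1) / (2 * \<delta>)"
    using L1 L2 by (simp add: M.prob_space E1)
  also have "\<dots> \<le> \<delta> / 2 + \<delta>\<^sup>2 / (2 * \<delta>)"
    using E2 \<delta> by (intro add_left_mono divide_right_mono) auto
  also have "\<dots> = \<delta>" using \<delta> by (simp add: power2_eq_square)
  finally show ?thesis by simp
qed

section \<open>The lower bound\<close>

lemma inverse_sqrt_power_le:
  assumes x: "0 \<le> x" "x \<le> 1 / 2"
  shows "(1 / sqrt (1 - x)) ^ n \<le> exp (real n * x)"
proof -
  have "1 \<le> (1 - x) * (1 + 2 * x)"
    using mult_nonneg_nonneg[of x "1 - 2 * x"] x by (simp add: algebra_simps)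
  also have "\<dots> \<le> (1 - x) * exp (2 * x)"
    using x exp_ge_add_one_self[of "2 * x"] by (intro mult_left_mono) auto
  finally have "1 / (1 - x) \<le> exp (2 * x)" using x by (simp add: field_simps)
  then have "sqrt (1 / (1 - x)) \<le> sqrt (exp (2 * x))" by (rule real_sqrt_le_mono)
  also have "sqrt (exp (2 * x)) = exp x" by (rule real_sqrt_unique) (simp_all add: exp_double)
  finally have "1 / sqrt (1 - x) \<le> exp x" by (simp add: real_sqrt_divide)
  then have "(1 / sqrt (1 - x)) ^ n \<le> exp x ^ n" using x by (intro power_mono) auto
  then show ?thesis by (simp add: exp_of_nat_mult)
qed

lemma law_close_to_zero_coeff:
  assumes \<sigma>: "\<sigma> > 0" and \<delta>: "\<delta> > 0"
    and small: "sqnorm p \<beta> / \<sigma>\<^sup>2 \<le> 1 / 4" "2 * real n * (sqnorm p \<beta> / \<sigma>\<^sup>2) \<le> ln (1 + \<delta>\<^sup>2)"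
    and B: "B \<in> sets (sample_space n p)"
  shows "measure (law n p (zero_coeff p, 1\<^sub>m p, \<sigma>)) B \<le> measure (law n p (\<beta>, 1\<^sub>m p, \<sigma>)) B + \<delta>"
proof -
  let ?x = "2 * (sqnorm p \<beta> / \<sigma>\<^sup>2)"
  note LR = sample_likelihood_ratio[where n=n and p=p and \<beta>=\<beta>, OF \<sigma>]
  have "(1 / sqrt (1 - ?x)) ^ n \<le> exp (real n * ?x)"
  proof (rule inverse_sqrt_power_le)
    show "0 \<le> ?x" by simp
    show "?x \<le> 1 / 2" using small(1) by linarith
  qed
  also have "\<dots> \<le> 1 + \<delta>\<^sup>2"
  proof -
    have "real n * ?x = 2 * real n * (sqnorm p \<beta> / \<sigma>\<^sup>2)" by simp
    then have "exp (real n * ?x) \<le> exp (ln (1 + \<delta>\<^sup>2))" using small(2) by (simp only: exp_le_cancel_iff)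
    also have "\<dots> = 1 + \<delta>\<^sup>2" by (rule exp_ln) (simp add: add_pos_nonneg)
    finally show ?thesis .
  qed
  finally have "(1 / sqrt (1 - ?x)) ^ n \<le> 1 + \<delta>\<^sup>2" .
  then have second: "(\<integral>\<^sup>+z. ennreal ((\<Prod>i<n. row_ratio p \<beta> \<sigma> (z i))\<^sup>2) \<partial>law n p (zero_coeff p, 1\<^sub>m p, \<sigma>)) \<le> ennreal (1 + \<delta>\<^sup>2)"
  proof -
    have "?x < 1" using small(1) by linarith
    then show ?thesis using LR(3) \<open>(1 / sqrt (1 - ?x)) ^ n \<le> 1 + \<delta>\<^sup>2\<close> by (simp only: ennreal_leI)
  qed
  have B': "B \<in> sets (law n p (zero_coeff p, 1\<^sub>m p, \<sigma>))" using B by (simp only: sets_law)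
  have D: "prob_space (density (law n p (zero_coeff p, 1\<^sub>m p, \<sigma>)) (\<lambda>z. ennreal (\<Prod>i<n. row_ratio p \<beta> \<sigma> (z i))))"
    using prob_space_law[OF \<sigma>, of n p \<beta>] by (simp only: LR(2))
  have "0 \<le> (\<Prod>i<n. row_ratio p \<beta> \<sigma> (z i))" for z
    by (intro prod_nonneg) (simp add: row_ratio_def)
  from measure_le_measure_density_add[OF prob_space_law[OF \<sigma>] D LR(1) this second \<delta> B']
  show ?thesis by (simp only: LR(2))
qed

text \<open>Under the zero vector, an interval misses F 0 with probability at most \<alpha> and F \<beta> with
probability at most \<alpha> + \<delta>. Whenever it misses neither, its length is at least t.\<close>

lemma minimax_length_ge_two_point:
  assumes \<sigma>: "\<sigma> > 0" and \<alpha>: "0 < \<alpha>" "\<alpha> < 1" and \<delta>: "\<delta> > 0"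
    and \<beta>: "\<beta> \<in> {..<p} \<rightarrow>\<^sub>E UNIV" "l0_norm p \<beta> \<le> k"
    and small: "sqnorm p \<beta> / \<sigma>\<^sup>2 \<le> 1 / 4" "2 * real n * (sqnorm p \<beta> / \<sigma>\<^sup>2) \<le> ln (1 + \<delta>\<^sup>2)"
    and gap: "F \<beta> - F (zero_coeff p) = t" "t \<ge> 0"
  shows "ennreal (t * (1 - 2 * \<alpha> - \<delta>)) \<le> minimax_length n p \<alpha> (param_known p k \<sigma>) F"
  unfolding minimax_length_def
proof (rule INF_greatest)
  fix CI assume CI: "CI \<in> conf_intervals n p \<alpha> (param_known p k \<sigma>) F"
  obtain l u where lu: "CI = (l, u)" by (cases CI)
  let ?S = "sample_space n p"
  let ?\<theta>0 = "(zero_coeff p, 1\<^sub>m p, \<sigma>)" and ?\<theta>1 = "(\<beta>, 1\<^sub>m p, \<sigma>)"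
  let ?P0 = "law n p ?\<theta>0" and ?P1 = "law n p ?\<theta>1"
  interpret P0: prob_space ?P0 by (rule prob_space_law[OF \<sigma>])
  interpret P1: prob_space ?P1 by (rule prob_space_law[OF \<sigma>])
  have meas: "l \<in> borel_measurable ?S" "u \<in> borel_measurable ?S" and le: "\<And>z. z \<in> space ?S \<Longrightarrow> l z \<le> u z"
    and cover: "ennreal (1 - \<alpha>) \<le> (INF \<theta>\<in>param_known p k \<sigma>. emeasure (law n p \<theta>) {z \<in> space ?S. l z \<le> F (fst \<theta>) \<and> F (fst \<theta>) \<le> u z})"
    using CI unfolding conf_intervals_def lu mem_Collect_eq prod.case by blast+
  have \<theta>0: "?\<theta>0 \<in> param_known p k \<sigma>"
    by (auto simp: param_known_def zero_coeff_def l0_norm_def vec_supp_def)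
  have \<theta>1: "?\<theta>1 \<in> param_known p k \<sigma>" using \<beta> by (auto simp: param_known_def)
  define C where "C a = {z \<in> space ?S. l z \<le> a \<and> a \<le> u z}" for a
  have C: "C a \<in> sets ?S" for a
  proof -
    have "C a = {z \<in> space ?S. l z \<le> a} \<inter> {z \<in> space ?S. a \<le> u z}" by (auto simp: C_def)
    then show ?thesis
      using meas by (simp only:) (intro sets.Int borel_measurable_le borel_measurable_const; assumption)
  qed
  have C0: "1 - \<alpha> \<le> measure ?P0 (C (F (zero_coeff p)))"
    using order_trans[OF cover INF_lower[OF \<theta>0]] \<alpha> by (simp add: P0.emeasure_eq_measure C_def)
  have C1: "1 - \<alpha> \<le> measure ?P1 (C (F \<beta>))"
    using order_trans[OF cover INF_lower[OF \<theta>1]] \<alpha> by (simp add: P1.emeasure_eq_measure C_def)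
  have compl0: "measure ?P0 (space ?S - A) = 1 - measure ?P0 A" if "A \<in> sets ?S" for A
    using P0.prob_compl[of A] that by (simp only: sets_law space_law)
  have compl1: "measure ?P1 (space ?S - A) = 1 - measure ?P1 A" if "A \<in> sets ?S" for A
    using P1.prob_compl[of A] that by (simp only: sets_law space_law)
  let ?A = "C (F (zero_coeff p)) \<inter> C (F \<beta>)"
  have A: "?A \<in> sets ?S" using C by (intro sets.Int)
  have "measure ?P0 (space ?S - C (F \<beta>)) \<le> measure ?P1 (space ?S - C (F \<beta>)) + \<delta>"
    using C by (intro law_close_to_zero_coeff[OF \<sigma> \<delta> small] sets.compl_sets)
  then have 1: "measure ?P0 (space ?S - C (F \<beta>)) \<le> \<alpha> + \<delta>"
    using C1 compl1[OF C] by simp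
  have 0: "measure ?P0 (space ?S - C (F (zero_coeff p))) \<le> \<alpha>"
    using C0 compl0[OF C] by simp
  have "measure ?P0 (space ?S - ?A) = measure ?P0 ((space ?S - C (F (zero_coeff p))) \<union> (space ?S - C (F \<beta>)))"
    by (simp only: Diff_Int)
  also have "\<dots> \<le> measure ?P0 (space ?S - C (F (zero_coeff p))) + measure ?P0 (space ?S - C (F \<beta>))"
    using C by (intro measure_Un_le) (simp_all only: sets_law sets.compl_sets)
  finally have PA: "1 - 2 * \<alpha> - \<delta> \<le> measure ?P0 ?A"
    using 0 1 compl0[OF A] by simp
  have "ennreal (t * (1 - 2 * \<alpha> - \<delta>)) \<le> ennreal (t * measure ?P0 ?A)"
    using PA gap by (intro ennreal_leI mult_left_mono)
  also have "\<dots> = (\<integral>\<^sup>+z. ennreal t * indicator ?A z \<partial>?P0)"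
    using A gap by (subst nn_integral_cmult_indicator) (simp_all add: sets_law P0.emeasure_eq_measure ennreal_mult')
  also have "\<dots> \<le> (\<integral>\<^sup>+z. ennreal (u z - l z) \<partial>?P0)"
  proof (rule nn_integral_mono)
    fix z assume "z \<in> space ?P0"
    then show "ennreal t * indicator ?A z \<le> ennreal (u z - l z)"
      using gap by (auto simp: indicator_def C_def intro!: ennreal_leI)
  qed
  also have "\<dots> = expected_length n p ?\<theta>0 CI" by (simp add: expected_length_def lu)
  also have "\<dots> \<le> (SUP \<theta>\<in>param_known p k \<sigma>. expected_length n p \<theta> CI)"
    by (rule SUP_upper[OF \<theta>0])
  finally show "ennreal (t * (1 - 2 * \<alpha> - \<delta>)) \<le> (SUP \<theta>\<in>param_known p k \<sigma>. expected_length n p \<theta> CI)" .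
qed

lemma sqnorm_eq_sum_supp: "sqnorm p v = (\<Sum>j\<in>vec_supp p v. (v j)\<^sup>2)"
  unfolding sqnorm_def by (rule sum.mono_neutral_right) (auto simp: vec_supp_def)

lemma loadings_sqnorm_pos:
  assumes "\<xi> \<in> loadings p q cbar"
  shows "sqnorm p \<xi> > 0"
proof -
  have "\<exists>j<p. \<xi> j \<noteq> 0"
  proof (rule ccontr)
    assume "\<not> (\<exists>j<p. \<xi> j \<noteq> 0)"
    then have "\<xi> = (\<lambda>j\<in>{..<p}. 0)"
      using assms by (auto simp: loadings_def PiE_def extensional_def)
    then show False using assms by (simp add: loadings_def)
  qed
  then obtain j where "j < p" "\<xi> j \<noteq> 0" by blast
  then have "sqnorm p \<xi> \<noteq> 0" using sqnorm_eq_0D by blast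
  then show ?thesis using sqnorm_nonneg[of p \<xi>] by linarith
qed

text \<open>Let m be the smallest absolute value of a nonzero entry. Every nonzero entry lies between m and
cbar m in absolute value, so any min k q entries of the support carry the stated fraction of the squared norm.\<close>

lemma loadings_sparse_part:
  assumes \<xi>: "\<xi> \<in> loadings p q cbar" and q: "1 \<le> q" "real q \<le> C * real k" and k: "1 \<le> k"
    and c: "cbar \<ge> 1" and C: "C > 0"
  obtains S where "S \<subseteq> vec_supp p \<xi>" "card S \<le> k"
    "min 1 (1 / C) / cbar\<^sup>2 * sqnorm p \<xi> \<le> (\<Sum>j\<in>S. (\<xi> j)\<^sup>2)"
proof -
  let ?V = "vec_supp p \<xi>"
  have V: "finite ?V" "card ?V = q" using \<xi> by (auto simp: loadings_def l0_norm_def vec_supp_def)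
  then have ne: "?V \<noteq> {}" using q by auto
  define m where "m = (MIN j\<in>?V. \<bar>\<xi> j\<bar>)"
  have m: "m \<le> \<bar>\<xi> j\<bar>" if "j \<in> ?V" for j
    unfolding m_def using V that by (intro Min_le) auto
  have "m \<in> (\<lambda>j. \<bar>\<xi> j\<bar>) ` ?V" unfolding m_def using V ne by (intro Min_in) auto
  then have m0: "m \<ge> 0" by auto
  have up: "\<bar>\<xi> j\<bar> \<le> cbar * m" if "j \<in> ?V" for j
  proof -
    have "\<bar>\<xi> j\<bar> \<le> (MAX j\<in>?V. \<bar>\<xi> j\<bar>)" using V that by (intro Max_ge) auto
    also have "\<dots> \<le> cbar * m" using \<xi> by (simp add: loadings_def m_def)
    finally show ?thesis .
  qed
  have "min k q \<le> card ?V" using V(2) by simp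
  then obtain S where S: "S \<subseteq> ?V" "card S = min k q"
    by (rule obtain_subset_with_card_n)
  have upper: "sqnorm p \<xi> \<le> real q * (cbar * m)\<^sup>2"
  proof -
    have "sqnorm p \<xi> \<le> (\<Sum>j\<in>?V. (cbar * m)\<^sup>2)"
      unfolding sqnorm_eq_sum_supp
    proof (rule sum_mono)
      fix j assume "j \<in> ?V"
      from up[OF this] have "\<bar>\<xi> j\<bar>\<^sup>2 \<le> (cbar * m)\<^sup>2" by (rule power_mono) simp
      then show "(\<xi> j)\<^sup>2 \<le> (cbar * m)\<^sup>2" by simp
    qed
    then show ?thesis using V by simp
  qed
  have lower: "real (min k q) * m\<^sup>2 \<le> (\<Sum>j\<in>S. (\<xi> j)\<^sup>2)"
  proof -
    have "(\<Sum>j\<in>S. m\<^sup>2) \<le> (\<Sum>j\<in>S. (\<xi> j)\<^sup>2)"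
    proof (rule sum_mono)
      fix j assume "j \<in> S"
      then have "m \<le> \<bar>\<xi> j\<bar>" using S m by auto
      then have "m\<^sup>2 \<le> \<bar>\<xi> j\<bar>\<^sup>2" using m0 by (rule power_mono)
      then show "m\<^sup>2 \<le> (\<xi> j)\<^sup>2" by simp
    qed
    then show ?thesis using S by simp
  qed
  have ratio: "min 1 (1 / C) * real q \<le> real (min k q)"
  proof (cases "q \<le> k")
    case True
    have "min 1 (1 / C) * real q \<le> 1 * real q" by (intro mult_right_mono) auto
    then show ?thesis using True by simp
  next
    case False
    have "min 1 (1 / C) * real q \<le> 1 / C * real q" by (intro mult_right_mono) auto
    also have "1 / C * real q \<le> real k" using q(2) C by (simp add: pos_divide_le_eq mult.commute)
    finally have "min 1 (1 / C) * real q \<le> real k" .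
    moreover have "min k q = k" using False by simp
    ultimately show ?thesis by (simp only:)
  qed
  have "min 1 (1 / C) / cbar\<^sup>2 * sqnorm p \<xi> \<le> min 1 (1 / C) / cbar\<^sup>2 * (real q * (cbar * m)\<^sup>2)"
    using upper C c by (intro mult_left_mono) auto
  also have "\<dots> = min 1 (1 / C) * real q * m\<^sup>2"
    using c by (simp add: power_mult_distrib)
  also have "\<dots> \<le> real (min k q) * m\<^sup>2" using ratio by (intro mult_right_mono) auto
  also note lower
  finally show ?thesis using S that by auto
qed

lemma minimax_length_lower_bound:
  assumes \<alpha>: "0 < \<alpha>" "\<alpha> < 1 / 2" and \<sigma>: "\<sigma> > 0" and c: "cbar \<ge> 1" and C: "C > 0"
  obtains c\<^sub>1 :: real where "c\<^sub>1 > 0"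
    "\<And>n p k q \<xi>. \<lbrakk>1 \<le> n; 1 \<le> k; 1 \<le> q; real q \<le> C * real k; \<xi> \<in> loadings p q cbar\<rbrakk> \<Longrightarrow>
      ennreal (c\<^sub>1 * (L2_set \<xi> {..<p} / sqrt (real n))) \<le> minimax_length n p \<alpha> (param_known p k \<sigma>) (lin_fun p \<xi>)"
proof -
  define \<delta> where "\<delta> = (1 - 2 * \<alpha>) / 2"
  have \<delta>: "\<delta> > 0" using \<alpha> by (simp add: \<delta>_def)
  \<comment> \<open>n times the signal-to-noise ratio of the alternative, small enough for total variation \<delta>\<close>
  define s where "s = min (1 / 4) (ln (1 + \<delta>\<^sup>2) / 2)"
  have ln: "ln (1 + \<delta>\<^sup>2) > 0" using \<delta> by (intro ln_gt_zero) simp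
  then have s: "s > 0" "s \<le> 1 / 4" "2 * s \<le> ln (1 + \<delta>\<^sup>2)" by (auto simp: s_def)
  define \<kappa> where "\<kappa> = min 1 (1 / C) / cbar\<^sup>2"
  have \<kappa>: "\<kappa> > 0" using C c by (simp add: \<kappa>_def)
  show thesis
  proof (rule that[of "\<sigma> * sqrt (s * \<kappa>) * \<delta>"])
    show "\<sigma> * sqrt (s * \<kappa>) * \<delta> > 0" using \<sigma> s \<kappa> \<delta> by simp
    fix n p k q :: nat and \<xi>
    assume n: "1 \<le> n" and k: "1 \<le> k" and q: "1 \<le> q" "real q \<le> C * real k" and \<xi>: "\<xi> \<in> loadings p q cbar"
    obtain S where S: "S \<subseteq> vec_supp p \<xi>" "card S \<le> k" and mass: "\<kappa> * sqnorm p \<xi> \<le> (\<Sum>j\<in>S. (\<xi> j)\<^sup>2)"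
      using loadings_sparse_part[OF \<xi> q k c C] unfolding \<kappa>_def by blast
    let ?Q = "\<Sum>j\<in>S. (\<xi> j)\<^sup>2"
    have Sp: "S \<subseteq> {..<p}" using S by (auto simp: vec_supp_def)
    have "\<kappa> * sqnorm p \<xi> > 0" using \<kappa> loadings_sqnorm_pos[OF \<xi>] by simp
    then have Q: "?Q > 0" using mass by linarith
    define t where "t = \<sigma> * sqrt (s / (real n * ?Q))"
    have t: "t \<ge> 0" using \<sigma> s Q by (simp add: t_def)
    define \<beta> where "\<beta> = (\<lambda>j\<in>{..<p}. if j \<in> S then t * \<xi> j else 0)"
    have part: "(\<Sum>j<p. if j \<in> S then f j else 0) = (\<Sum>j\<in>S. f j)" for f :: "nat \<Rightarrow> real"
      using Sp by (subst sum.inter_restrict[symmetric]) (auto simp: Int_absorb1)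
    have "sqnorm p \<beta> = (\<Sum>j<p. if j \<in> S then t\<^sup>2 * (\<xi> j)\<^sup>2 else 0)"
      unfolding sqnorm_def \<beta>_def by (intro sum.cong) (auto simp: power_mult_distrib)
    also have "\<dots> = t\<^sup>2 * ?Q" unfolding part by (simp add: sum_distrib_left)
    also have "\<dots> = s * \<sigma>\<^sup>2 / real n"
      using s Q n by (simp add: t_def power_mult_distrib)
    finally have sq: "sqnorm p \<beta> / \<sigma>\<^sup>2 = s / real n" using \<sigma> by simp
    have "lin_fun p \<xi> \<beta> = (\<Sum>j<p. if j \<in> S then t * (\<xi> j)\<^sup>2 else 0)"
      unfolding lin_fun_def \<beta>_def by (intro sum.cong) (auto simp: power2_eq_square)
    also have "\<dots> = t * ?Q" unfolding part by (simp add: sum_distrib_left)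
    finally have gap: "lin_fun p \<xi> \<beta> - lin_fun p \<xi> (zero_coeff p) = t * ?Q" by simp
    have "vec_supp p \<beta> \<subseteq> S" by (auto simp: vec_supp_def \<beta>_def split: if_splits)
    then have "card (vec_supp p \<beta>) \<le> card S" using Sp finite_subset by (intro card_mono) auto
    then have \<beta>: "\<beta> \<in> {..<p} \<rightarrow>\<^sub>E UNIV" "l0_norm p \<beta> \<le> k"
      using S by (auto simp: l0_norm_def \<beta>_def)
    have small: "sqnorm p \<beta> / \<sigma>\<^sup>2 \<le> 1 / 4" "2 * real n * (sqnorm p \<beta> / \<sigma>\<^sup>2) \<le> ln (1 + \<delta>\<^sup>2)"
    proof -
      have "s / real n \<le> s" using s n by (simp add: field_simps)
      then show "sqnorm p \<beta> / \<sigma>\<^sup>2 \<le> 1 / 4" using s(2) unfolding sq by linarith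
      show "2 * real n * (sqnorm p \<beta> / \<sigma>\<^sup>2) \<le> ln (1 + \<delta>\<^sup>2)" using s n sq by simp
    qed
    have "\<alpha> < 1" using \<alpha> by simp
    from minimax_length_ge_two_point[OF \<sigma> \<alpha>(1) this \<delta> \<beta> small gap]
    have low: "ennreal (t * ?Q * (1 - 2 * \<alpha> - \<delta>)) \<le> minimax_length n p \<alpha> (param_known p k \<sigma>) (lin_fun p \<xi>)"
      using t Q by simp
    have "\<sigma> * sqrt (s * \<kappa>) * \<delta> * (L2_set \<xi> {..<p} / sqrt (real n)) = \<sigma> * \<delta> * sqrt (s / real n * (\<kappa> * sqnorm p \<xi>))"
      by (simp add: L2_set_eq_sqrt_sqnorm real_sqrt_mult real_sqrt_divide)
    also have "\<dots> \<le> \<sigma> * \<delta> * sqrt (s / real n * ?Q)"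
      using mass \<sigma> \<delta> s by (intro mult_left_mono real_sqrt_le_mono) auto
    also have "\<dots> = t * ?Q * (1 - 2 * \<alpha> - \<delta>)"
    proof -
      have "s / real n * ?Q = s / (real n * ?Q) * ?Q\<^sup>2" using Q by (simp add: power2_eq_square)
      then have "sqrt (s / real n * ?Q) = sqrt (s / (real n * ?Q)) * ?Q"
        using Q by (simp only: real_sqrt_mult real_sqrt_abs abs_of_pos)
      moreover have "1 - 2 * \<alpha> - \<delta> = \<delta>" by (simp add: \<delta>_def field_simps)
      ultimately show ?thesis by (simp add: t_def)
    qed
    finally show "ennreal (\<sigma> * sqrt (s * \<kappa>) * \<delta> * (L2_set \<xi> {..<p} / sqrt (real n)))
        \<le> minimax_length n p \<alpha> (param_known p k \<sigma>) (lin_fun p \<xi>)"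
      using low by (meson ennreal_leI order_trans)
  qed
qed

section \<open>The upper bound\<close>

text \<open>The constant 1 / 48 balances the union bound: the logarithm of the number of grid vectors is at most
8 k ln p \<le> n / 6, while the first half contributes at most exp (- n / 3). The remaining exp (- n / 6)
is at most \<alpha> / 4 for large n.\<close>

lemma minimax_length_upper_bound:
  assumes \<alpha>: "0 < \<alpha>" "\<alpha> < 1" and \<sigma>: "\<sigma> > 0"
  obtains C\<^sub>1 :: real and N :: nat where "C\<^sub>1 > 0"
    "\<And>n p k \<xi>. \<lbrakk>n \<ge> N; p \<ge> N; real k \<le> 1 / 48 * (real n / ln (real p)); sqnorm p \<xi> > 0\<rbrakk> \<Longrightarrow>
      minimax_length n p \<alpha> (param_known p k \<sigma>) (lin_fun p \<xi>) \<le> ennreal (C\<^sub>1 * (L2_set \<xi> {..<p} / sqrt (real n)))"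
proof -
  define V where "V = score_const (pilot_error (8 / \<alpha>) \<sigma>) \<sigma>"
  have V: "V > 0" by (simp add: V_def score_const_def add_pos_nonneg)
  \<comment> \<open>for n \<ge> N1, exp (- n / 6) \<le> \<alpha> / 4\<close>
  obtain N1 :: nat where N1: "real N1 \<ge> 6 * ln (4 / \<alpha>)" using real_arch_simple by blast
  \<comment> \<open>for p \<ge> N2, the Frobenius bound with K = 8 / \<alpha> meets the condition of the lower isometry\<close>
  obtain N2 :: nat where N2: "real N2 \<ge> 32 / (\<alpha> * small_ball_const)" using real_arch_simple by blast
  define N where "N = max 3 (max N1 N2)"
  show thesis
  proof (rule that[of "2 * sqrt (4 * V / \<alpha>)" N])
    show "2 * sqrt (4 * V / \<alpha>) > 0" using V \<alpha> by simp
    fix n p k :: nat and \<xi> :: "nat \<Rightarrow> real"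
    assume N: "n \<ge> N" "p \<ge> N" and k: "real k \<le> 1 / 48 * (real n / ln (real p))" and s: "sqnorm p \<xi> > 0"
    have n: "n \<ge> 3" "real n \<ge> 6 * ln (4 / \<alpha>)" using N(1) N1 by (auto simp: N_def)
    have p: "p \<ge> 3" "real p \<ge> 32 / (\<alpha> * small_ball_const)" using N(2) N2 by (auto simp: N_def)
    define r where "r = sqrt (4 * V / \<alpha>) * (sqrt (sqnorm p \<xi>) / sqrt (real n))"
    have r: "r > 0" "r\<^sup>2 = 4 * V / \<alpha> * (sqnorm p \<xi> / real n)"
      using V \<alpha> s n by (simp_all add: r_def power_mult_distrib power_divide)
    let ?I = "{..<n div 2}" and ?J = "{n div 2..<n}"
    let ?h = "real (card ?I)" and ?m = "real (card ?J)"
    have h: "?h \<ge> real n / 3" using n unfolding card_lessThan by linarith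
    have m: "?m \<ge> real n / 2" unfolding card_atLeastLessThan by linarith
    have "32 / \<alpha> \<le> small_ball_const * real p"
      using p(2) \<alpha> small_ball_const_pos by (simp add: field_simps)
    also have "\<dots> \<le> small_ball_const * (real p)\<^sup>2"
      using p(1) small_ball_const_pos by (simp add: power2_eq_square)
    finally have p': "32 / \<alpha> \<le> small_ball_const * (real p)\<^sup>2" .
    have small: "real p ^ (8 * k) * exp (- ?h) \<le> \<alpha> / 4"
    proof -
      have lnp: "ln (real p) > 0" using p(1) by simp
      have "real p ^ (8 * k) = exp (real (8 * k) * ln (real p))"
        using p(1) by (subst exp_of_nat_mult) simp
      then have "real p ^ (8 * k) * exp (- ?h) = exp (8 * (real k * ln (real p)) - ?h)"
        by (simp add: exp_add[symmetric] mult.assoc)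
      also have "\<dots> \<le> exp (- ln (4 / \<alpha>))"
      proof -
        have "real k * ln (real p) \<le> real n / 48" using k lnp by (simp add: field_simps)
        then have "8 * (real k * ln (real p)) - ?h \<le> - ln (4 / \<alpha>)" using h n(2) by linarith
        then show ?thesis by simp
      qed
      also have "\<dots> = \<alpha> / 4" using \<alpha> by (simp add: exp_minus)
      finally show ?thesis .
    qed
    have wide: "2 * sqnorm p \<xi> * V \<le> \<alpha> * (?m * r\<^sup>2)"
    proof -
      have "2 * sqnorm p \<xi> * V = \<alpha> * (real n / 2 * r\<^sup>2)"
        unfolding r(2) using \<alpha> n by simp
      also have "\<dots> \<le> \<alpha> * (?m * r\<^sup>2)"
        using m \<alpha> by (intro mult_left_mono mult_right_mono) auto
      finally show ?thesis .
    qed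
    have "0 \<in> ?I" "n div 2 \<in> ?J" using n(1) by auto
    then have ne: "?I \<noteq> {}" "?J \<noteq> {}" by blast+
    have un: "?I \<inter> ?J = {}" "?I \<union> ?J = {..<n}" by auto
    note IJ = finite_lessThan[of "n div 2"] ne(1) finite_atLeastLessThan[of "n div 2" n] ne(2) un
    define T where "T = (\<lambda>z. debiased p ?J \<xi> (pilot p k ?I (pilot_level (8 / \<alpha>) \<sigma> * ?h) z) z)"
    have T: "T \<in> borel_measurable (sample_space n p)"
      unfolding sample_space_def T_def by (rule measurable_debiased_pilot) auto
    have "emeasure (law n p (\<beta>, 1\<^sub>m p, \<sigma>)) {z \<in> space (sample_space n p). r \<le> \<bar>T z - lin_fun p \<xi> \<beta>\<bar>} \<le> ennreal \<alpha>"
      if "l0_norm p \<beta> \<le> k" for \<beta>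
      unfolding T_def by (rule sample_split_coverage[OF \<sigma> \<alpha>(1) p(1) p' IJ that s r(1) small wide[unfolded V_def]])
    from minimax_length_le_fixed_width[OF \<sigma> \<alpha> r(1) T this]
    have "minimax_length n p \<alpha> (param_known p k \<sigma>) (lin_fun p \<xi>) \<le> ennreal (2 * r)" .
    then show "minimax_length n p \<alpha> (param_known p k \<sigma>) (lin_fun p \<xi>)
        \<le> ennreal (2 * sqrt (4 * V / \<alpha>) * (L2_set \<xi> {..<p} / sqrt (real n)))"
      by (simp only: r_def L2_set_eq_sqrt_sqnorm mult.assoc)
  qed
qed

section \<open>The minimax rate\<close>

theorem theorem7:
  fixes \<alpha> \<gamma> \<sigma>\<^sub>0 cbar C :: real
  assumes "0 < \<alpha>" "\<alpha> < 1 / 2" "0 \<le> \<gamma>" "\<gamma> < 1 / 2" "\<sigma>\<^sub>0 > 0" "cbar \<ge> 1" "C > 0"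
  shows "\<exists>c c\<^sub>1 C\<^sub>1 :: real. c > 0 \<and> c\<^sub>1 > 0 \<and> C\<^sub>1 > 0 \<and>
    (\<exists>N :: nat. \<forall>n p :: nat. n \<ge> N \<longrightarrow> p \<ge> N \<longrightarrow>
      (\<forall>k :: nat. k \<ge> 1 \<longrightarrow> real k \<le> c * min (real p powr \<gamma>) (real n / ln (real p)) \<longrightarrow>
        (\<forall>q :: nat. 1 \<le> q \<longrightarrow> real q \<le> C * real k \<longrightarrow>
          (\<forall>\<xi>\<in>loadings p q cbar.
            ennreal (c\<^sub>1 * (L2_set \<xi> {..<p} / sqrt (real n)))
              \<le> minimax_length n p \<alpha> (param_known p k \<sigma>\<^sub>0) (lin_fun p \<xi>) \<and>
            minimax_length n p \<alpha> (param_known p k \<sigma>\<^sub>0) (lin_fun p \<xi>)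
              \<le> ennreal (C\<^sub>1 * (L2_set \<xi> {..<p} / sqrt (real n)))))))"
proof -
  obtain c\<^sub>1 :: real where c1: "c\<^sub>1 > 0" and low: "\<And>n p k q \<xi>. \<lbrakk>1 \<le> n; 1 \<le> k; 1 \<le> q; real q \<le> C * real k; \<xi> \<in> loadings p q cbar\<rbrakk> \<Longrightarrow>
      ennreal (c\<^sub>1 * (L2_set \<xi> {..<p} / sqrt (real n))) \<le> minimax_length n p \<alpha> (param_known p k \<sigma>\<^sub>0) (lin_fun p \<xi>)"
    using minimax_length_lower_bound[OF assms(1,2,5,6,7)] by metis
  have "\<alpha> < 1" using assms(2) by simp
  from minimax_length_upper_bound[OF assms(1) this assms(5)]
  obtain C\<^sub>1 :: real and N :: nat where C1: "C\<^sub>1 > 0" and up: "\<And>n p k \<xi>. \<lbrakk>n \<ge> N; p \<ge> N; real k \<le> 1 / 48 * (real n / ln (real p)); sqnorm p \<xi> > 0\<rbrakk> \<Longrightarrow>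
      minimax_length n p \<alpha> (param_known p k \<sigma>\<^sub>0) (lin_fun p \<xi>) \<le> ennreal (C\<^sub>1 * (L2_set \<xi> {..<p} / sqrt (real n)))"
    by metis
  show ?thesis
  proof (rule exI[of _ "1 / 48 :: real"], rule exI[of _ c\<^sub>1], rule exI[of _ C\<^sub>1],
      intro conjI c1 C1 exI[of _ "max 1 N"] allI impI ballI)
    fix n p k q :: nat and \<xi>
    assume n: "max 1 N \<le> n" and p: "max 1 N \<le> p" and k: "1 \<le> k"
      and kc: "real k \<le> 1 / 48 * min (real p powr \<gamma>) (real n / ln (real p))"
      and q: "1 \<le> q" "real q \<le> C * real k" and \<xi>: "\<xi> \<in> loadings p q cbar"
    show "ennreal (c\<^sub>1 * (L2_set \<xi> {..<p} / sqrt (real n))) \<le> minimax_length n p \<alpha> (param_known p k \<sigma>\<^sub>0) (lin_fun p \<xi>)"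
      using low[OF _ k q \<xi>] n by simp
    have "real k \<le> 1 / 48 * (real n / ln (real p))" using kc by linarith
    then show "minimax_length n p \<alpha> (param_known p k \<sigma>\<^sub>0) (lin_fun p \<xi>) \<le> ennreal (C\<^sub>1 * (L2_set \<xi> {..<p} / sqrt (real n)))"
      using up[OF _ _ _ loadings_sqnorm_pos[OF \<xi>]] n p by simp
  qed simp
qed

end
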